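(* Consider a stagewise independent multistage stochastic program with the regularization, standing assumptions and deterministic sampling dual dynamic programming algorithm described in the context. Let $\epsilon>0$ and choose $\delta_t>0$, $0\le t\le T-1$, with $\sum_{t=0}^{T-1}\delta_t=\epsilon$. Let $\{\mathcal B_{t,k}\subset\mathbb R^{d_t}\}_{1\le k\le K_t,\,0\le t\le T-1}$ be a collection of balls (in the norm $\|\cdot\|$), $\mathcal B_{t,k}$ having diameter $D_{t,k}\ge0$, such that $\mathcal X_t\subseteq\bigcup_{k=1}^{K_t}\mathcal B_{t,k}$ for $0\le t\le T-1$. If the algorithm with tolerance $\epsilon$ terminates with an $\epsilon$-optimal root node solution $(x_0^*,y_0^* )$ in $i$ iterations, then $$i\le\sum_{t=0}^{T-1}\sum_{k=1}^{K_t}\left(1+\frac{2L_tD_{t,k}}{\delta_t}\right)^{d_t}.$$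
   Context: **Problem.** $T\ge1$. For each stage $t=1,\dots,T$ there is a finite set $\tilde{\mathcal N}(t)$ of distinct nodes; $\tilde{\mathcal N}(0)=\{r\}$. Node $m\in\tilde{\mathcal N}(t)$, $t\ge1$, is realized with probability $p_{t-1,m}>0$ independently of the past, $\sum_{m\in\tilde{\mathcal N}(t)}p_{t-1,m}=1$. Each node $m\in\tilde{\mathcal N}(t)$ has a compact set $\mathcal F_m$ of pairs $(x,y)$ in a Euclidean space, and for $t\le T-1$ its projection onto the $x$-coordinates is the same set $\mathcal X_t\subset\mathbb R^{d_t}$ for all $m\in\tilde{\mathcal N}(t)$; $\mathcal X_{-1}=\{0\}$ and $x_{-1}=0$. The cost $f_m(z,y,x)\in[0,+\infty]$, defined for $z\in\mathcal X_{t-1}$, $(x,y)\in\mathcal F_m$, is lower semicontinuous. The scenario tree has as stage-$t$ nodes the sequences $n=(n_1,\dots,n_t)$, $n_s\in\tilde{\mathcal N}(s)$ (the root being the empty sequence), with the data of $n_t$, probability $p_n=\prod_{s\le t}p_{s-1,n_s}$ and parent $a(n)=(n_1,\dots,n_{t-1})$; the original problem is to minimize $\sum_n p_nf_n(x_{a(n)},y_n,x_n)$ over $(x_n,y_n)\in\mathcal F_n$ for all tree nodes $n$, and it is assumed to have a feasible solution with finite objective. Fix a norm $\|\cdot\|$ with dual norm $\|\cdot\|_*$. **Regularization.** A penalty function is $\psi:\mathbb R^d\to\mathbb R_+$ with $\psi(x)=0$ iff $x=0$ and with the diameter of $\{\psi\le a\}$ tending to $0$ as $a\to0$. For each $m\in\tilde{\mathcal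 N}(t)$ a penalty function $\psi_m$, 1-Lipschitz on $\mathcal X_{t-1}-\mathcal X_{t-1}$, and $\sigma_m>0$ are given. With $\mathcal Q_T^{\mathrm R}\equiv0$ and $\mathcal Q_t^{\mathrm R}(x)=\sum_{m\in\tilde{\mathcal N}(t+1)}p_{t,m}Q_m^{\mathrm R}(x)$ for $t<T$, define for $m\in\tilde{\mathcal N}(t)$ $$Q_m^{\mathrm R}(x_{t-1})=\min_{(x,y)\in\mathcal F_m,\ z\in\mathcal X_{t-1}}\{f_m(z,y,x)+\sigma_m\psi_m(x_{t-1}-z)+\mathcal Q_t^{\mathrm R}(x)\}.$$ $v^{\mathrm{reg}}=\min_{(x,y)\in\mathcal F_r}\{f_r(0,y,x)+\mathcal Q_0^{\mathrm R}(x)\}$; $(x_0,y_0)\in\mathcal F_r$ is an $\epsilon$-optimal root node solution if $f_r(0,y_0,x_0)+\mathcal Q_0^{\mathrm R}(x_0)\le v^{\mathrm{reg}}+\epsilon$. Standing assumption (exactness): every optimal solution of the problem of minimizing $\sum_n p_n(f_n(z_n,y_n,x_n)+\sigma_n\psi_n(x_{a(n)}-z_n))$ over $(x_n,y_n)\in\mathcal F_n$, $z_n\in\mathcal X_{t(n)-1}$ for all scenario tree nodes $n$ (where $t(n)$ is the stage of $n$) satisfies $z_n=x_{a(n)}$ for all $n$. The problem is called convex if all $\mathcal F_m,f_m,\psi_m$ are convex. For $m\neq r$ let $\mathcal U_m=\{(\lambda,\rho):\|\lambda\|_*\le l_{m,\lambda},\ 0\le\rho\le l_{m,\rho}\}$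 with given nonnegative bounds satisfying $l_{m,\lambda}\ge\sigma_m,\ l_{m,\rho}=0$ in the convex case with $\psi_m=\|\cdot\|$, and $l_{m,\rho}\ge\sigma_m$ otherwise. Put $L_t=\sum_{m\in\tilde{\mathcal N}(t+1)}p_{t,m}(l_{m,\lambda}+l_{m,\rho})$ for $0\le t\le T-1$. **Deterministic sampling algorithm with tolerance $\epsilon$.** "An optimal solution" means any optimal solution returned by a given oracle. Initialize $\underline{\mathcal Q}_t^0\equiv0$ for all $t$, $\overline{\mathcal Q}_t^0\equiv+\infty$ for $t\le T-1$, and $\underline{\mathcal Q}_T^i\equiv\overline{\mathcal Q}_T^i\equiv0$ for all $i$. Let $(x_0^1,y_0^1)$ be an optimal solution of $\min_{(x,y)\in\mathcal F_r}f_r(0,y,x)$, $\mathrm{LB}=f_r(0,y_0^1,x_0^1)$, $\mathrm{UB}=+\infty$. For $i=1,2,\dots$, while $\mathrm{UB}-\mathrm{LB}>\epsilon$, iteration $i$ is: (Forward) for $t=1,\dots,T$: for each $n\in\tilde{\mathcal N}(t)$, $(x_n^i,y_n^i,z_n^i)$ is an optimal solution of $\min_{(x,y)\in\mathcal F_n,z\in\mathcal X_{t-1}}\{f_n(z,y,x)+\sigma_n\psi_n(x_{t-1}^i-z)+\underline{\mathcal Q}_t^{i-1}(x)\}$; if $t\le T-1$, let $\gamma_n^i=\overline{\mathcal Q}_t^{i-1}(x_n^i)-\underline{\mathcal Q}_t^{i-1}(x_n^i)$, select any $n^*\in\tilde{\mathcal N}(t)$ with $\gamma_{n^*}^i\ge\gamma_n^i$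 for all $n\in\tilde{\mathcal N}(t)$, and set $x_t^i=x_{n^*}^i$. (Backward) for $t=T,\dots,1$: if $t<T$, set $\underline{\mathcal Q}_t^i(x)=\max\{\underline{\mathcal Q}_t^{i-1}(x),\sum_{m\in\tilde{\mathcal N}(t+1)}p_{t,m}C_m^i(x)\}$ and let $\overline{\mathcal Q}_t^i$ be $\mathrm{conv}\{\overline{\mathcal Q}_t^{i-1},h_t^i\}$ in the convex case and $\min\{\overline{\mathcal Q}_t^{i-1},h_t^i\}$ otherwise, where $h_t^i(x)=\sum_{m\in\tilde{\mathcal N}(t+1)}p_{t,m}(\bar v_m^i+\sigma_m\|x-x_t^i\|)$ and $\mathrm{conv}\{f,g\}$ is the convex biconjugate of $\min\{f,g\}$ on $\mathbb R^{d_t}$. Then for each $n\in\tilde{\mathcal N}(t)$ let $\underline v_n^i$ be the optimal value and $(\hat\lambda_n^i,\hat\rho_n^i)$ an optimal outer solution of $\max_{(\lambda,\rho)\in\mathcal U_n}\min_{(x,y)\in\mathcal F_n,z\in\mathcal X_{t-1}}\{f_n(z,y,x)+\langle\lambda,x_{t-1}^i-z\rangle+\rho\psi_n(x_{t-1}^i-z)+\underline{\mathcal Q}_t^i(x)\}$; set $C_n^i(x)=-\langle\hat\lambda_n^i,x_{t-1}^i-x\rangle-\hat\rho_n^i\psi_n(x_{t-1}^i-x)+\underline v_n^i$ and $\bar v_n^i=f_n(z_n^i,y_n^i,x_n^i)+\sigma_n\psi_n(x_{t-1}^i-z_n^i)+\overline{\mathcal Q}_t^i(x_n^i)$. (Root)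 update $\underline{\mathcal Q}_0^i,\overline{\mathcal Q}_0^i$ by the same formulas with $t=0$; let $(x_0^{i+1},y_0^{i+1})$ be an optimal solution of $\min_{(x,y)\in\mathcal F_r}\{f_r(0,y,x)+\underline{\mathcal Q}_0^i(x)\}$; set $\mathrm{LB}=f_r(0,y_0^{i+1},x_0^{i+1})+\underline{\mathcal Q}_0^i(x_0^{i+1})$; if $\mathrm{UB}>f_r(0,y_0^{i+1},x_0^{i+1})+\overline{\mathcal Q}_0^i(x_0^{i+1})$, set $\mathrm{UB}$ to this value and $(x_0^*,y_0^* )=(x_0^{i+1},y_0^{i+1})$. *)

theory Defs
  imports "HOL-Analysis.Analysis"
begin

section \<open>Norms, penalty functions and extended-real-valued functions on a subspace\<close>

text \<open>
  The dimension of the state space varies with the stage, so each \<open>\<real>\<^sup>d\<close> is rendered as a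
  \<open>d\<close>-dimensional linear subspace \<open>E\<close> of one Euclidean space \<open>'a\<close>. Any finite family of
  coordinate spaces embeds isometrically in a common \<open>'a\<close> in this way. The pairing is the inner
  product of \<open>'a\<close>; the norm \<open>\<nu>\<close> fixed on \<open>E\<close> is arbitrary.
\<close>

definition norm_on :: "'a::real_vector set \<Rightarrow> ('a \<Rightarrow> real) \<Rightarrow> bool" where
  "norm_on E \<nu> \<longleftrightarrow>
     (\<forall>u\<in>E. 0 \<le> \<nu> u \<and> (\<nu> u = 0 \<longleftrightarrow> u = 0)) \<and>
     (\<forall>u\<in>E. \<forall>c. \<nu> (c *\<^sub>R u) = \<bar>c\<bar> * \<nu> u) \<and>
     (\<forall>u\<in>E. \<forall>v\<in>E. \<nu> (u + v) \<le> \<nu> u + \<nu> v)"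

definition dual_norm_on :: "'a::real_inner set \<Rightarrow> ('a \<Rightarrow> real) \<Rightarrow> 'a \<Rightarrow> real" where
  "dual_norm_on E \<nu> l = (SUP u\<in>{u\<in>E. \<nu> u \<le> 1}. l \<bullet> u)"

text \<open>Extended-real-valued, so that the diameter of an unbounded set is \<open>\<infinity>\<close>; the set is to be nonempty.\<close>

definition norm_diameter :: "('a::real_vector \<Rightarrow> real) \<Rightarrow> 'a set \<Rightarrow> ereal" where
  "norm_diameter \<nu> S = (SUP (u, v)\<in>S \<times> S. ereal (\<nu> (u - v)))"

definition norm_ball :: "'a::real_vector set \<Rightarrow> ('a \<Rightarrow> real) \<Rightarrow> 'a set \<Rightarrow> bool" where
  "norm_ball E \<nu> B \<longleftrightarrow>
     (\<exists>c\<in>E. (\<exists>\<rho>\<ge>0. B = {u\<in>E. \<nu> (u - c) \<le> \<rho>}) \<or> (\<exists>\<rho>>0. B = {u\<in>E. \<nu> (u - c) < \<rho>}))"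

definition penalty_on :: "'a::real_vector set \<Rightarrow> ('a \<Rightarrow> real) \<Rightarrow> ('a \<Rightarrow> real) \<Rightarrow> bool" where
  "penalty_on E \<nu> \<psi> \<longleftrightarrow>
     (\<forall>u\<in>E. 0 \<le> \<psi> u \<and> (\<psi> u = 0 \<longleftrightarrow> u = 0)) \<and>
     ((\<lambda>a. norm_diameter \<nu> {u\<in>E. \<psi> u \<le> a}) \<longlongrightarrow> 0) (at_right 0)"

definition lsc_on :: "'a::topological_space set \<Rightarrow> ('a \<Rightarrow> ereal) \<Rightarrow> bool" where
  "lsc_on S g \<longleftrightarrow> (\<forall>w\<in>S. g w \<le> Liminf (at w within S) g)"

definition econvex_on :: "'a::real_vector set \<Rightarrow> ('a \<Rightarrow> ereal) \<Rightarrow> bool" where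
  "econvex_on S g \<longleftrightarrow> convex S \<and>
     (\<forall>v\<in>S. \<forall>w\<in>S. \<forall>a\<in>{0..1}.
        g ((1 - a) *\<^sub>R v + a *\<^sub>R w) \<le> ereal (1 - a) * g v + ereal a * g w)"

definition conjugate_on :: "'a::real_inner set \<Rightarrow> ('a \<Rightarrow> ereal) \<Rightarrow> 'a \<Rightarrow> ereal" where
  "conjugate_on E g s = (SUP u\<in>E. ereal (s \<bullet> u) - g u)"

definition biconjugate_on :: "'a::real_inner set \<Rightarrow> ('a \<Rightarrow> ereal) \<Rightarrow> 'a \<Rightarrow> ereal" where
  "biconjugate_on E g = conjugate_on E (conjugate_on E g)"

section \<open>Stagewise independent multistage stochastic programs\<close>

text \<open>
  With \<open>T = horizon P\<close>: \<open>nodes P t\<close> is the node set of stage \<open>t \<le> T\<close>; \<open>trans P t m\<close> is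
  \<open>p\<^bsub>t,m\<^esub>\<close> for \<open>m\<close> in stage \<open>t + 1\<close>; \<open>feas P m\<close> is the set of feasible pairs \<open>(x, y)\<close>;
  \<open>stagecost P m z y x\<close> is \<open>f\<^sub>m(z, y, x)\<close>; \<open>sspace P t\<close>, \<open>snorm P t\<close> and \<open>states P t\<close>
  (for \<open>t < T\<close>) are \<open>\<real>\<^bsup>d\<^esup>\<close> for \<open>d = d\<^sub>t\<close>, its norm and the state set \<open>\<X>\<^sub>t\<close>;
  \<open>pen P m\<close> and \<open>pcoef P m\<close> are \<open>\<psi>\<^sub>m\<close> and \<open>\<sigma>\<^sub>m\<close>; \<open>lbnd P m\<close> and \<open>rbnd P m\<close> bound \<open>\<lambda>\<close> and
  \<open>\<rho>\<close> in the dual problem of node \<open>m\<close>.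
\<close>

record ('n, 'a, 'b) msp =
  horizon :: nat
  root :: 'n
  nodes :: "nat \<Rightarrow> 'n set"
  trans :: "nat \<Rightarrow> 'n \<Rightarrow> real"
  feas :: "'n \<Rightarrow> ('a \<times> 'b) set"
  stagecost :: "'n \<Rightarrow> 'a \<Rightarrow> 'b \<Rightarrow> 'a \<Rightarrow> ereal"
  sspace :: "nat \<Rightarrow> 'a set"
  snorm :: "nat \<Rightarrow> 'a \<Rightarrow> real"
  states :: "nat \<Rightarrow> 'a set"
  pen :: "'n \<Rightarrow> 'a \<Rightarrow> real"
  pcoef :: "'n \<Rightarrow> real"
  lbnd :: "'n \<Rightarrow> real"
  rbnd :: "'n \<Rightarrow> real"

text \<open>
  State data entering stage \<open>t\<close>, with \<open>\<X>\<^bsub>-1\<^esub> = {0}\<close>. At \<open>t = 0\<close> the norm \<open>snorm P (0 - 1) =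
  snorm P 0\<close> is only ever evaluated at \<open>0\<close>.
\<close>

definition prev_space :: "('n, 'a::zero, 'b) msp \<Rightarrow> nat \<Rightarrow> 'a set" where
  "prev_space P t = (if t = 0 then {0} else sspace P (t - 1))"

definition prev_states :: "('n, 'a::zero, 'b) msp \<Rightarrow> nat \<Rightarrow> 'a set" where
  "prev_states P t = (if t = 0 then {0} else states P (t - 1))"

definition msp_program :: "('n, 'a::euclidean_space, 'b::euclidean_space) msp \<Rightarrow> bool" where
  "msp_program P \<longleftrightarrow>
     1 \<le> horizon P \<and>
     nodes P 0 = {root P} \<and>
     (\<forall>t\<le>horizon P. finite (nodes P t)) \<and>
     (\<forall>s\<le>horizon P. \<forall>t\<le>horizon P. s \<noteq> t \<longrightarrow> nodes P s \<inter> nodes P t = {}) \<and>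
     (\<forall>t<horizon P. (\<forall>m\<in>nodes P (Suc t). 0 < trans P t m) \<and>
        (\<Sum>m\<in>nodes P (Suc t). trans P t m) = 1) \<and>
     (\<forall>t<horizon P. subspace (sspace P t) \<and> norm_on (sspace P t) (snorm P t) \<and>
        states P t \<subseteq> sspace P t \<and> (\<forall>m\<in>nodes P t. fst ` feas P m = states P t)) \<and>
     (\<forall>t\<le>horizon P. \<forall>m\<in>nodes P t. compact (feas P m) \<and>
        (\<forall>z\<in>prev_states P t. \<forall>(x, y)\<in>feas P m. 0 \<le> stagecost P m z y x) \<and>
        lsc_on (prev_states P t \<times> feas P m) (\<lambda>(z, x, y). stagecost P m z y x))"

definition msp_penalties :: "('n, 'a::euclidean_space, 'b::euclidean_space) msp \<Rightarrow> bool" where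
  "msp_penalties P \<longleftrightarrow>
     (\<forall>t\<le>horizon P. \<forall>m\<in>nodes P t.
        penalty_on (prev_space P t) (snorm P (t - 1)) (pen P m) \<and>
        (\<forall>u\<in>{v - w |v w. v \<in> prev_states P t \<and> w \<in> prev_states P t}.
         \<forall>u'\<in>{v - w |v w. v \<in> prev_states P t \<and> w \<in> prev_states P t}.
           \<bar>pen P m u - pen P m u'\<bar> \<le> snorm P (t - 1) (u - u')) \<and>
        0 < pcoef P m)"

definition convex_problem :: "('n, 'a::euclidean_space, 'b::euclidean_space) msp \<Rightarrow> bool" where
  "convex_problem P \<longleftrightarrow>
     (\<forall>t\<le>horizon P. \<forall>m\<in>nodes P t.
        convex (feas P m) \<and>
        econvex_on (prev_states P t \<times> feas P m) (\<lambda>(z, x, y). stagecost P m z y x) \<and>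
        convex_on (prev_space P t) (pen P m))"

definition norm_penalties :: "('n, 'a::euclidean_space, 'b::euclidean_space) msp \<Rightarrow> bool" where
  "norm_penalties P \<longleftrightarrow>
     (\<forall>t\<in>{1..horizon P}. \<forall>m\<in>nodes P t. \<forall>u\<in>sspace P (t - 1). pen P m u = snorm P (t - 1) u)"

text \<open>
  The alternative between the two kinds of dual bounds is made once for the whole problem. It may
  not be made node by node: if, in a convex problem, only some penalty functions are norms, then the
  cuts coming from the other nodes need not be convex, and with \<open>\<rho> = 0\<close> enforced at an earlier
  stage a duality gap may remain there.
\<close>

definition msp_dual_bounds :: "('n, 'a::euclidean_space, 'b::euclidean_space) msp \<Rightarrow> bool" where
  "msp_dual_bounds P \<longleftrightarrow>
     (\<forall>t\<in>{1..horizon P}. \<forall>m\<in>nodes P t.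
        0 \<le> lbnd P m \<and> 0 \<le> rbnd P m \<and>
        (if convex_problem P \<and> norm_penalties P
         then pcoef P m \<le> lbnd P m \<and> rbnd P m = 0
         else pcoef P m \<le> rbnd P m))"

definition lip_const :: "('n, 'a, 'b) msp \<Rightarrow> nat \<Rightarrow> real" where
  "lip_const P t = (\<Sum>m\<in>nodes P (Suc t). trans P t m * (lbnd P m + rbnd P m))"

section \<open>The scenario tree\<close>

text \<open>A tree node of stage \<open>t\<close> is a list \<open>[n\<^sub>1, \<dots>, n\<^sub>t]\<close>; thus \<open>n\<^sub>s\<close> is \<open>n ! (s - 1)\<close>.\<close>

definition tree :: "('n, 'a, 'b) msp \<Rightarrow> 'n list set" where
  "tree P = {n. length n \<le> horizon P \<and> (\<forall>s<length n. n ! s \<in> nodes P (Suc s))}"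

definition tree_data :: "('n, 'a, 'b) msp \<Rightarrow> 'n list \<Rightarrow> 'n" where
  "tree_data P n = (if n = [] then root P else last n)"

definition tree_prob :: "('n, 'a, 'b) msp \<Rightarrow> 'n list \<Rightarrow> real" where
  "tree_prob P n = (\<Prod>s<length n. trans P s (n ! s))"

definition parent_state :: "('n list \<Rightarrow> 'a::zero) \<Rightarrow> 'n list \<Rightarrow> 'a" where
  "parent_state x n = (if n = [] then 0 else x (butlast n))"

definition tree_feasible ::
  "('n, 'a, 'b) msp \<Rightarrow> ('n list \<Rightarrow> 'a) \<Rightarrow> ('n list \<Rightarrow> 'b) \<Rightarrow> bool" where
  "tree_feasible P x y \<longleftrightarrow> (\<forall>n\<in>tree P. (x n, y n) \<in> feas P (tree_data P n))"

definition tree_cost ::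
  "('n, 'a::zero, 'b) msp \<Rightarrow> ('n list \<Rightarrow> 'a) \<Rightarrow> ('n list \<Rightarrow> 'b) \<Rightarrow> ereal" where
  "tree_cost P x y =
     (\<Sum>n\<in>tree P. ereal (tree_prob P n) *
        stagecost P (tree_data P n) (parent_state x n) (y n) (x n))"

definition finite_feasible :: "('n, 'a::zero, 'b) msp \<Rightarrow> bool" where
  "finite_feasible P \<longleftrightarrow> (\<exists>x y. tree_feasible P x y \<and> tree_cost P x y < \<infinity>)"

definition reg_tree_cost ::
  "('n, 'a::real_vector, 'b) msp \<Rightarrow>
     ('n list \<Rightarrow> 'a) \<times> ('n list \<Rightarrow> 'b) \<times> ('n list \<Rightarrow> 'a) \<Rightarrow> ereal" where
  "reg_tree_cost P = (\<lambda>(x, y, z).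
     (\<Sum>n\<in>tree P. ereal (tree_prob P n) *
        (stagecost P (tree_data P n) (z n) (y n) (x n) +
         ereal (pcoef P (tree_data P n) * pen P (tree_data P n) (parent_state x n - z n)))))"

definition reg_exact :: "('n, 'a::real_vector, 'b) msp \<Rightarrow> bool" where
  "reg_exact P \<longleftrightarrow>
     (\<forall>x y z.
        is_arg_min (reg_tree_cost P)
          (\<lambda>(x, y, z). tree_feasible P x y \<and> (\<forall>n\<in>tree P. z n \<in> prev_states P (length n)))
          (x, y, z) \<longrightarrow>
        (\<forall>n\<in>tree P. z n = parent_state x n))"

section \<open>Regularized value functions\<close>

text \<open>
  Decision triples are written \<open>((x, y), z)\<close>. In the following definitions \<open>m\<close> is a stage \<open>t\<close>
  node, \<open>V\<close> the stage \<open>t\<close> expected cost-to-go function and \<open>u\<close> the state \<open>x\<^bsub>t-1\<^esub>\<close>.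
\<close>

definition node_feas :: "('n, 'a::zero, 'b) msp \<Rightarrow> nat \<Rightarrow> 'n \<Rightarrow> (('a \<times> 'b) \<times> 'a) set" where
  "node_feas P t m = feas P m \<times> prev_states P t"

definition node_cost ::
  "('n, 'a::real_vector, 'b) msp \<Rightarrow> 'n \<Rightarrow> ('a \<Rightarrow> ereal) \<Rightarrow> 'a \<Rightarrow> ('a \<times> 'b) \<times> 'a \<Rightarrow> ereal" where
  "node_cost P m V u = (\<lambda>((x, y), z).
     stagecost P m z y x + ereal (pcoef P m * pen P m (u - z)) + V x)"

definition node_value ::
  "('n, 'a::real_vector, 'b) msp \<Rightarrow> nat \<Rightarrow> 'n \<Rightarrow> ('a \<Rightarrow> ereal) \<Rightarrow> 'a \<Rightarrow> ereal" where
  "node_value P t m V u = (INF w\<in>node_feas P t m. node_cost P m V u w)"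

function reg_ctg :: "('n, 'a::real_vector, 'b) msp \<Rightarrow> nat \<Rightarrow> 'a \<Rightarrow> ereal" where
  "reg_ctg P t =
     (if t < horizon P
      then (\<lambda>x. \<Sum>m\<in>nodes P (Suc t).
                   ereal (trans P t m) * node_value P (Suc t) m (reg_ctg P (Suc t)) x)
      else (\<lambda>x. 0))"
  by pat_completeness auto
termination by (relation "Wellfounded.measure (\<lambda>(P, t). horizon P - t)") auto

declare reg_ctg.simps [simp del]

definition root_cost :: "('n, 'a::zero, 'b) msp \<Rightarrow> ('a \<Rightarrow> ereal) \<Rightarrow> 'a \<times> 'b \<Rightarrow> ereal" where
  "root_cost P V = (\<lambda>(x, y). stagecost P (root P) 0 y x + V x)"

definition reg_value :: "('n, 'a::real_vector, 'b) msp \<Rightarrow> ereal" where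
  "reg_value P = (INF w\<in>feas P (root P). root_cost P (reg_ctg P 0) w)"

definition eps_optimal_root ::
  "('n, 'a::real_vector, 'b) msp \<Rightarrow> real \<Rightarrow> 'a \<times> 'b \<Rightarrow> bool" where
  "eps_optimal_root P \<epsilon> w \<longleftrightarrow>
     w \<in> feas P (root P) \<and> root_cost P (reg_ctg P 0) w \<le> reg_value P + ereal \<epsilon>"

section \<open>The dual problem of a node\<close>

definition dual_feas :: "('n, 'a::euclidean_space, 'b) msp \<Rightarrow> nat \<Rightarrow> 'n \<Rightarrow> ('a \<times> real) set" where
  "dual_feas P t m =
     {(l, \<rho>). l \<in> prev_space P t \<and>
        dual_norm_on (prev_space P t) (snorm P (t - 1)) l \<le> lbnd P m \<and> 0 \<le> \<rho> \<and> \<rho> \<le> rbnd P m}"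

definition dual_inner ::
  "('n, 'a::euclidean_space, 'b) msp \<Rightarrow> nat \<Rightarrow> 'n \<Rightarrow> ('a \<Rightarrow> ereal) \<Rightarrow> 'a \<Rightarrow> 'a \<times> real \<Rightarrow> ereal" where
  "dual_inner P t m V u = (\<lambda>(l, \<rho>).
     (INF ((x, y), z)\<in>node_feas P t m.
        stagecost P m z y x + ereal (l \<bullet> (u - z) + \<rho> * pen P m (u - z)) + V x))"

definition dual_value ::
  "('n, 'a::euclidean_space, 'b) msp \<Rightarrow> nat \<Rightarrow> 'n \<Rightarrow> ('a \<Rightarrow> ereal) \<Rightarrow> 'a \<Rightarrow> ereal" where
  "dual_value P t m V u = (SUP w\<in>dual_feas P t m. dual_inner P t m V u w)"

section \<open>Runs of the deterministic sampling algorithm\<close>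

text \<open>
  A run records what the algorithm computes; the superscript \<open>i\<close> of an iterate is always the first
  argument: \<open>state R i t\<close> is \<open>x\<^sub>t\<^sup>i\<close>, \<open>root_y R i\<close> is \<open>y\<^sub>0\<^sup>i\<close>, \<open>sol R i n\<close> is
  \<open>((x\<^sub>n\<^sup>i, y\<^sub>n\<^sup>i), z\<^sub>n\<^sup>i)\<close>, \<open>mult R i n\<close> is the outer dual solution of node \<open>n\<close>, and
  \<open>under R i t\<close>, \<open>over R i t\<close> are the lower and upper approximations of the stage \<open>t\<close> expected
  cost-to-go function. \<open>LB R i\<close>, \<open>UB R i\<close> and \<open>best R i\<close> are the values of \<open>LB\<close>, \<open>UB\<close> and
  \<open>(x\<^sub>0\<^sup>*, y\<^sub>0\<^sup>*)\<close> after iteration \<open>i\<close>, \<open>i = 0\<close> being the initialization. An oracle is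
  represented by the requirement that what it returns is optimal.
\<close>

record ('n, 'a, 'b) ddp_trace =
  state :: "nat \<Rightarrow> nat \<Rightarrow> 'a"
  root_y :: "nat \<Rightarrow> 'b"
  sol :: "nat \<Rightarrow> 'n \<Rightarrow> ('a \<times> 'b) \<times> 'a"
  mult :: "nat \<Rightarrow> 'n \<Rightarrow> 'a \<times> real"
  under :: "nat \<Rightarrow> nat \<Rightarrow> 'a \<Rightarrow> ereal"
  over :: "nat \<Rightarrow> nat \<Rightarrow> 'a \<Rightarrow> ereal"
  LB :: "nat \<Rightarrow> ereal"
  UB :: "nat \<Rightarrow> ereal"
  best :: "nat \<Rightarrow> 'a \<times> 'b"

definition sol_x :: "('n, 'a, 'b) ddp_trace \<Rightarrow> nat \<Rightarrow> 'n \<Rightarrow> 'a" where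
  "sol_x R i n = fst (fst (sol R i n))"

definition gap :: "('n, 'a, 'b) ddp_trace \<Rightarrow> nat \<Rightarrow> nat \<Rightarrow> 'n \<Rightarrow> ereal" where
  "gap R i t n = over R (i - 1) t (sol_x R i n) - under R (i - 1) t (sol_x R i n)"

text \<open>
  For a stage \<open>t\<close> node \<open>n\<close>: the optimal value of its dual problem, the cut \<open>C\<^sub>n\<^sup>i\<close>, and the
  value of its forward solution under the upper approximation.
\<close>

definition low_val ::
  "('n, 'a::euclidean_space, 'b) msp \<Rightarrow> ('n, 'a, 'b) ddp_trace \<Rightarrow> nat \<Rightarrow> nat \<Rightarrow> 'n \<Rightarrow> ereal" where
  "low_val P R i t n = dual_value P t n (under R i t) (state R i (t - 1))"

definition cut ::
  "('n, 'a::euclidean_space, 'b) msp \<Rightarrow> ('n, 'a, 'b) ddp_trace \<Rightarrow> nat \<Rightarrow> nat \<Rightarrow> 'n \<Rightarrow> 'a \<Rightarrow> ereal" where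
  "cut P R i t n x =
     ereal (- (fst (mult R i n) \<bullet> (state R i (t - 1) - x))
            - snd (mult R i n) * pen P n (state R i (t - 1) - x))
     + low_val P R i t n"

definition up_val ::
  "('n, 'a::euclidean_space, 'b) msp \<Rightarrow> ('n, 'a, 'b) ddp_trace \<Rightarrow> nat \<Rightarrow> nat \<Rightarrow> 'n \<Rightarrow> ereal" where
  "up_val P R i t n = node_cost P n (over R i t) (state R i (t - 1)) (sol R i n)"

definition over_piece ::
  "('n, 'a::euclidean_space, 'b) msp \<Rightarrow> ('n, 'a, 'b) ddp_trace \<Rightarrow> nat \<Rightarrow> nat \<Rightarrow> 'a \<Rightarrow> ereal" where
  "over_piece P R i t x =
     (\<Sum>m\<in>nodes P (Suc t). ereal (trans P t m) *
        (up_val P R i (Suc t) m + ereal (pcoef P m * snorm P t (x - state R i t))))"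

definition update_under ::
  "('n, 'a::euclidean_space, 'b) msp \<Rightarrow> ('n, 'a, 'b) ddp_trace \<Rightarrow> nat \<Rightarrow> nat \<Rightarrow> 'a \<Rightarrow> ereal" where
  "update_under P R i t x =
     max (under R (i - 1) t x)
         (\<Sum>m\<in>nodes P (Suc t). ereal (trans P t m) * cut P R i (Suc t) m x)"

definition update_over ::
  "('n, 'a::euclidean_space, 'b::euclidean_space) msp \<Rightarrow> ('n, 'a, 'b) ddp_trace \<Rightarrow>
     nat \<Rightarrow> nat \<Rightarrow> 'a \<Rightarrow> ereal" where
  "update_over P R i t =
     (let g = (\<lambda>x. min (over R (i - 1) t x) (over_piece P R i t x))
      in if convex_problem P then biconjugate_on (sspace P t) g else g)"

definition ddp_init ::
  "('n, 'a::euclidean_space, 'b::euclidean_space) msp \<Rightarrow> ('n, 'a, 'b) ddp_trace \<Rightarrow> bool" where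
  "ddp_init P R \<longleftrightarrow>
     (\<forall>t\<le>horizon P. under R 0 t = (\<lambda>x. 0)) \<and>
     (\<forall>t<horizon P. over R 0 t = (\<lambda>x. \<infinity>)) \<and>
     (\<forall>i. under R i (horizon P) = (\<lambda>x. 0) \<and> over R i (horizon P) = (\<lambda>x. 0)) \<and>
     is_arg_min (\<lambda>(x, y). stagecost P (root P) 0 y x) (\<lambda>w. w \<in> feas P (root P))
       (state R 1 0, root_y R 1) \<and>
     LB R 0 = stagecost P (root P) 0 (root_y R 1) (state R 1 0) \<and>
     UB R 0 = \<infinity>"

definition ddp_forward ::
  "('n, 'a::euclidean_space, 'b::euclidean_space) msp \<Rightarrow> ('n, 'a, 'b) ddp_trace \<Rightarrow> nat \<Rightarrow> bool" where
  "ddp_forward P R i \<longleftrightarrow>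
     (\<forall>t\<in>{1..horizon P}.
        (\<forall>n\<in>nodes P t.
           is_arg_min (node_cost P n (under R (i - 1) t) (state R i (t - 1)))
             (\<lambda>w. w \<in> node_feas P t n) (sol R i n)) \<and>
        (t < horizon P \<longrightarrow>
           (\<exists>n'. is_arg_max (gap R i t) (\<lambda>n. n \<in> nodes P t) n' \<and> state R i t = sol_x R i n')))"

definition ddp_backward ::
  "('n, 'a::euclidean_space, 'b::euclidean_space) msp \<Rightarrow> ('n, 'a, 'b) ddp_trace \<Rightarrow> nat \<Rightarrow> bool" where
  "ddp_backward P R i \<longleftrightarrow>
     (\<forall>t\<in>{1..horizon P}.
        (t < horizon P \<longrightarrow> under R i t = update_under P R i t \<and> over R i t = update_over P R i t) \<and>
        (\<forall>n\<in>nodes P t.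
           is_arg_max (dual_inner P t n (under R i t) (state R i (t - 1)))
             (\<lambda>w. w \<in> dual_feas P t n) (mult R i n)))"

definition ddp_root ::
  "('n, 'a::euclidean_space, 'b::euclidean_space) msp \<Rightarrow> ('n, 'a, 'b) ddp_trace \<Rightarrow> nat \<Rightarrow> bool" where
  "ddp_root P R i \<longleftrightarrow>
     under R i 0 = update_under P R i 0 \<and>
     over R i 0 = update_over P R i 0 \<and>
     is_arg_min (root_cost P (under R i 0)) (\<lambda>w. w \<in> feas P (root P))
       (state R (i + 1) 0, root_y R (i + 1)) \<and>
     LB R i = root_cost P (under R i 0) (state R (i + 1) 0, root_y R (i + 1)) \<and>
     (let w = (state R (i + 1) 0, root_y R (i + 1)); v = root_cost P (over R i 0) w
      in if UB R (i - 1) > v then UB R i = v \<and> best R i = w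
         else UB R i = UB R (i - 1) \<and> best R i = best R (i - 1))"

text \<open>The loop with tolerance \<open>\<epsilon>\<close> executes the iterations \<open>1, \<dots>, N\<close> and then stops.\<close>

definition ddp_terminates_in ::
  "('n, 'a::euclidean_space, 'b::euclidean_space) msp \<Rightarrow> real \<Rightarrow> ('n, 'a, 'b) ddp_trace \<Rightarrow>
     nat \<Rightarrow> bool" where
  "ddp_terminates_in P \<epsilon> R N \<longleftrightarrow>
     ddp_init P R \<and>
     (\<forall>i\<in>{1..N}. UB R (i - 1) - LB R (i - 1) > ereal \<epsilon> \<and>
        ddp_forward P R i \<and> ddp_backward P R i \<and> ddp_root P R i) \<and>
     UB R N - LB R N \<le> ereal \<epsilon>"

end

theory Submission
  imports Defs
begin

text \<open>
  Call the difference of the upper and the lower approximation at the visited state \<open>x\<^sub>t\<^sup>i\<close> the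
  stage \<open>t\<close> gap of iteration \<open>i\<close>. As long as the loop runs, the stage \<open>0\<close> gap exceeds
  \<open>\<epsilon> = \<Sum>\<^sub>s \<delta>\<^sub>s\<close>. Assign to iteration \<open>i\<close> the last stage \<open>t\<close> at which the gap exceeds
  \<open>\<Sum>\<^bsub>s\<ge>t\<^esub> \<delta>\<^sub>s\<close>. Then all gaps at stage \<open>t + 1\<close> are at most \<open>\<Sum>\<^bsub>s>t\<^esub> \<delta>\<^sub>s\<close>, and, since there is no
  duality gap in the node problems, so is the new stage \<open>t\<close> gap at \<open>x\<^sub>t\<^sup>i\<close> after the update. The
  new cut and the new upper piece are \<open>L\<^sub>t\<close>-Lipschitz, so a later iteration assigned to \<open>t\<close> visits a
  state at distance more than \<open>\<delta>\<^sub>t / (2 L\<^sub>t)\<close>. Comparing volumes bounds the number of such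
  states in each ball.
\<close>

section \<open>Norms on a subspace\<close>

lemma norm_onD:
  assumes "norm_on E \<nu>"
  shows norm_on_nonneg: "u \<in> E \<Longrightarrow> 0 \<le> \<nu> u"
    and norm_on_eq_0_iff: "u \<in> E \<Longrightarrow> \<nu> u = 0 \<longleftrightarrow> u = 0"
    and norm_on_scaleR: "u \<in> E \<Longrightarrow> \<nu> (c *\<^sub>R u) = \<bar>c\<bar> * \<nu> u"
    and norm_on_triangle: "u \<in> E \<Longrightarrow> v \<in> E \<Longrightarrow> \<nu> (u + v) \<le> \<nu> u + \<nu> v"
  using assms by (auto simp: norm_on_def)

lemma norm_on_minus:
  assumes "norm_on E \<nu>" "u \<in> E"
  shows "\<nu> (- u) = \<nu> u"
  using norm_on_scaleR[OF assms, of "-1"] by simp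

lemma norm_on_minus_commute:
  assumes "norm_on E \<nu>" "subspace E" "u \<in> E" "v \<in> E"
  shows "\<nu> (u - v) = \<nu> (v - u)"
  using norm_on_minus[OF assms(1), of "u - v"] assms by (simp add: subspace_diff)

lemma norm_on_diff_triangle:
  assumes "norm_on E \<nu>" "subspace E" "u \<in> E" "v \<in> E" "w \<in> E"
  shows "\<nu> (u - w) \<le> \<nu> (u - v) + \<nu> (v - w)"
  using norm_on_triangle[OF assms(1), of "u - v" "v - w"] assms by (simp add: subspace_diff)

text \<open>\<open>\<nu>\<close> is unconstrained off \<open>E\<close>. Precomposed with a linear
  map into \<open>E\<close> it becomes a real-valued convex function on the whole space.\<close>

lemma convex_on_norm_on_linear:
  fixes g :: "'b::real_vector \<Rightarrow> 'a::real_vector"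
  assumes "norm_on E \<nu>" "subspace E" "linear g" "range g \<subseteq> E"
  shows "convex_on UNIV (\<lambda>z. \<nu> (g z))"
proof (rule convex_onI)
  fix t :: real and x y :: 'b
  assume t: "0 < t" "t < 1"
  have g: "g z \<in> E" for z using assms(4) by auto
  have "\<nu> (g ((1 - t) *\<^sub>R x + t *\<^sub>R y)) = \<nu> ((1 - t) *\<^sub>R g x + t *\<^sub>R g y)"
    by (simp add: linear_add linear_cmul assms(3))
  also have "\<dots> \<le> \<nu> ((1 - t) *\<^sub>R g x) + \<nu> (t *\<^sub>R g y)"
    using assms(2) g by (intro norm_on_triangle[OF assms(1)] subspace_scale)
  finally show "\<nu> (g ((1 - t) *\<^sub>R x + t *\<^sub>R y)) \<le> (1 - t) * \<nu> (g x) + t * \<nu> (g y)"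
    using t g by (simp add: norm_on_scaleR[OF assms(1)])
qed auto

text \<open>A real-valued convex function on a finite-dimensional space is continuous.\<close>

lemma continuous_on_norm_on_linear:
  fixes g :: "'a::euclidean_space \<Rightarrow> 'b::real_vector"
  assumes "norm_on E \<nu>" "subspace E" "linear g" "range g \<subseteq> E"
  shows "continuous_on A (\<lambda>z. \<nu> (g z))"
  using convex_on_continuous[OF open_UNIV convex_on_norm_on_linear[OF assms]]
    continuous_on_subset by blast

lemma linear_retraction_subspace:
  fixes E :: "'a::euclidean_space set"
  assumes "subspace E"
  obtains g where "linear g" "range g \<subseteq> E" "\<And>u. u \<in> E \<Longrightarrow> g u = u"
  using linear_exists_left_inverse_on[of id E] assms by (auto simp: linear_id)

text \<open>Compactness of the unit sphere of \<open>W\<close>: a continuous positive function has a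
  positive minimum there, and homogeneity extends the bound to all of \<open>W\<close>.\<close>

lemma norm_on_linear_lower_bound:
  fixes f :: "'a::euclidean_space \<Rightarrow> 'b::euclidean_space"
  assumes "norm_on E \<nu>" "subspace E" "linear f" "subspace W" "f ` W \<subseteq> E" "inj_on f W"
  obtains \<kappa> where "0 < \<kappa>" "\<And>u. u \<in> W \<Longrightarrow> \<kappa> * norm u \<le> \<nu> (f u)"
proof -
  obtain g where g: "linear g" "range g \<subseteq> W" "\<And>u. u \<in> W \<Longrightarrow> g u = u"
    using linear_retraction_subspace[OF assms(4)] by blast
  define S where "S = sphere 0 1 \<inter> W"
  have comp: "compact S"
    unfolding S_def by (intro compact_Int_closed closed_subspace assms) auto
  \<comment> \<open>\<open>f\<close> is known to map into \<open>E\<close> only on \<open>W\<close>,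
    so continuity is derived for \<open>f \<circ> g\<close>, which agrees with \<open>f\<close> on
    \<open>S\<close>.\<close>
  have "continuous_on S (\<lambda>z. \<nu> ((f \<circ> g) z))"
    by (rule continuous_on_norm_on_linear[OF assms(1,2)])
      (use g assms linear_compose[OF g(1) assms(3)] in \<open>auto simp: o_def\<close>)
  then have cont: "continuous_on S (\<lambda>z. \<nu> (f z))"
    by (rule continuous_on_cong[THEN iffD1, rotated -1]) (auto simp: S_def g)
  have pos: "0 < \<nu> (f u)" if "u \<in> W" "u \<noteq> 0" for u
  proof -
    have "f u \<in> E" using assms that by auto
    moreover have "f u \<noteq> 0"
      using inj_onD[OF assms(6), of u 0] that subspace_0[OF assms(4)] linear_0[OF assms(3)] by auto
    ultimately show ?thesis
      using norm_on_nonneg[OF assms(1)] norm_on_eq_0_iff[OF assms(1)] by (simp add: less_le)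
  qed
  obtain \<kappa> where \<kappa>: "0 < \<kappa>" "\<And>u. u \<in> S \<Longrightarrow> \<kappa> \<le> \<nu> (f u)"
  proof (cases "S = {}")
    case True
    then show ?thesis using that[of 1] by auto
  next
    case False
    then obtain u0 where "u0 \<in> S" "\<And>u. u \<in> S \<Longrightarrow> \<nu> (f u0) \<le> \<nu> (f u)"
      using continuous_attains_inf[OF comp _ cont] by blast
    moreover from \<open>u0 \<in> S\<close> have "0 < \<nu> (f u0)" by (intro pos) (auto simp: S_def)
    ultimately show ?thesis using that by blast
  qed
  have "\<kappa> * norm u \<le> \<nu> (f u)" if "u \<in> W" for u
  proof (cases "u = 0")
    case True
    then show ?thesis
      using assms norm_on_nonneg[OF assms(1), of "f u"] that by auto
  next
    case False
    have "u /\<^sub>R norm u \<in> S" using False that assms by (auto simp: S_def subspace_scale)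
    from \<kappa>(2)[OF this] have "\<kappa> \<le> \<nu> (f u /\<^sub>R norm u)"
      by (simp add: linear_cmul assms(3))
    also have "\<dots> = \<nu> (f u) / norm u"
      using that assms(5) by (subst norm_on_scaleR[OF assms(1)]) (auto simp: field_simps)
    finally show ?thesis using False by (simp add: field_simps)
  qed
  with \<kappa>(1) show ?thesis using that by blast
qed

text \<open>A real supremum bounds its members only if the set is bounded above; the comparison with
  the Euclidean norm provides this. The claim follows by normalising \<open>u\<close>.\<close>

lemma inner_le_dual_norm_on:
  fixes E :: "'a::euclidean_space set"
  assumes "norm_on E \<nu>" "subspace E" "u \<in> E"
  shows "l \<bullet> u \<le> dual_norm_on E \<nu> l * \<nu> u"
proof (cases "u = 0")
  case True
  then show ?thesis using norm_on_eq_0_iff[OF assms(1,3)] by simp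
next
  case False
  then have pos: "0 < \<nu> u"
    using norm_on_nonneg[OF assms(1,3)] norm_on_eq_0_iff[OF assms(1,3)] by simp
  obtain \<kappa> where \<kappa>: "0 < \<kappa>" "\<And>u. u \<in> E \<Longrightarrow> \<kappa> * norm u \<le> \<nu> u"
    using norm_on_linear_lower_bound[OF assms(1,2) linear_id assms(2)] by auto
  have "l \<bullet> v \<le> norm l * (1 / \<kappa>)" if "v \<in> E" "\<nu> v \<le> 1" for v
  proof -
    have "norm v \<le> 1 / \<kappa>" using \<kappa>(1) \<kappa>(2)[OF that(1)] that(2) by (simp add: field_simps)
    then show ?thesis
      using norm_cauchy_schwarz[of l v] mult_left_mono[of "norm v" "1 / \<kappa>" "norm l"] by auto
  qed
  then have "bdd_above ((\<lambda>v. l \<bullet> v) ` {v\<in>E. \<nu> v \<le> 1})" by (intro bdd_aboveI2) blast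
  moreover have "u /\<^sub>R \<nu> u \<in> {v\<in>E. \<nu> v \<le> 1}"
    using assms pos by (auto simp: subspace_scale norm_on_scaleR[OF assms(1,3)])
  ultimately have "l \<bullet> (u /\<^sub>R \<nu> u) \<le> dual_norm_on E \<nu> l"
    unfolding dual_norm_on_def by (rule cSUP_upper[rotated])
  then show ?thesis using pos by (simp add: field_simps)
qed

lemma dual_norm_on_le:
  assumes "norm_on E \<nu>" "subspace E" "0 \<le> b" "\<And>u. u \<in> E \<Longrightarrow> l \<bullet> u \<le> b * \<nu> u"
  shows "dual_norm_on E \<nu> l \<le> b"
  unfolding dual_norm_on_def
proof (rule cSUP_least)
  show "{u\<in>E. \<nu> u \<le> 1} \<noteq> {}"
    using subspace_0[OF assms(2)] norm_on_eq_0_iff[OF assms(1), of 0] by auto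
  show "l \<bullet> u \<le> b" if "u \<in> {u\<in>E. \<nu> u \<le> 1}" for u
    using assms(4)[of u] that mult_left_mono[of "\<nu> u" 1 b] assms(3) by auto
qed

section \<open>Packing bound in a subspace\<close>

text \<open>Change of variables for a diagonal affine map; separate factors per coordinate allow
  scaling in some directions only.\<close>

lemma emeasure_lborel_affine_scaling:
  fixes c :: "'a::euclidean_space \<Rightarrow> real" and t :: 'a
  assumes "\<And>j. j \<in> Basis \<Longrightarrow> c j \<noteq> 0" and A: "A \<in> sets borel"
  shows "emeasure lborel A = ennreal (\<Prod>j\<in>Basis. \<bar>c j\<bar>) *
    emeasure lborel {x. t + (\<Sum>j\<in>Basis. (c j * (x \<bullet> j)) *\<^sub>R j) \<in> A}"
proof -
  let ?T = "\<lambda>x. t + (\<Sum>j\<in>Basis. (c j * (x \<bullet> j)) *\<^sub>R j)"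
  have [measurable]: "?T \<in> borel \<rightarrow>\<^sub>M borel" by simp
  have "emeasure lborel A = emeasure (density (distr lborel borel ?T) (\<lambda>_. \<Prod>j\<in>Basis. \<bar>c j\<bar>)) A"
    using lborel_affine_euclidean[of c t] assms by simp
  also have "\<dots> = ennreal (\<Prod>j\<in>Basis. \<bar>c j\<bar>) * emeasure lborel (?T -` A \<inter> space lborel)"
    using A by (simp add: emeasure_density nn_integral_cmult_indicator emeasure_distr)
  also have "?T -` A \<inter> space lborel = {x. ?T x \<in> A}" by auto
  finally show ?thesis .
qed

text \<open>
  The subspace is a null set of \<^typ>\<open>'a\<close>, so it is identified with the span of some coordinate
  directions \<open>W\<close> and every norm ball is thickened by a cube in the remaining directions; a homothety
  acting on \<open>W\<close> only then scales the volume by the power \<open>dim E\<close>.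
\<close>

lemma packing_bound:
  fixes E :: "'a::euclidean_space set"
  assumes E: "subspace E" and \<nu>: "norm_on E \<nu>" and F: "F \<subseteq> E" "finite F" and c: "c \<in> E"
    and ball: "\<And>x. x \<in> F \<Longrightarrow> \<nu> (x - c) \<le> \<rho>" and \<rho>: "0 \<le> \<rho>" and \<eta>: "0 < \<eta>"
    and sep: "\<And>x y. x \<in> F \<Longrightarrow> y \<in> F \<Longrightarrow> x \<noteq> y \<Longrightarrow> \<eta> \<le> \<nu> (x - y)"
  shows "real (card F) \<le> (1 + 2 * \<rho> / \<eta>) ^ dim E"
proof -
  obtain W :: "'a set" where W: "W \<subseteq> Basis" "card W = dim E" "finite W"
    using obtain_subset_with_card_n[of "dim E" "Basis :: 'a set"] dim_subset_UNIV[of E] by auto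
  have "dim (span W) = dim E"
    using W independent_mono[OF independent_Basis, of W] by (simp add: dim_eq_card_independent)
  then obtain f g where f: "linear f" "f ` span W = E" "\<And>x. x \<in> E \<Longrightarrow> g x \<in> span W"
      "\<And>x. x \<in> span W \<Longrightarrow> g (f x) = x" "\<And>x. x \<in> E \<Longrightarrow> f (g x) = x"
    using isometries_subspaces[OF subspace_span E, of W] by (metis imageI)
  define \<pi> where "\<pi> z = (\<Sum>b\<in>W. (z \<bullet> b) *\<^sub>R b)" for z
  have lin: "linear \<pi>"
    unfolding \<pi>_def by (intro linearI)
      (simp_all add: inner_add_left scaleR_add_left sum.distrib scaleR_sum_right)
  have \<pi>W: "\<pi> z \<in> span W" for z
    unfolding \<pi>_def by (intro span_sum span_scale span_base)
  have \<pi>_inner: "\<pi> z \<bullet> b = (if b \<in> W then z \<bullet> b else 0)" if "b \<in> Basis" for z b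
  proof -
    have "\<pi> z \<bullet> b = (\<Sum>b'\<in>W. (z \<bullet> b') * (if b' = b then 1 else 0))"
      unfolding \<pi>_def inner_sum_left using W that by (intro sum.cong) (auto simp: inner_Basis)
    also have "\<dots> = (if b \<in> W then z \<bullet> b else 0)" using W(3) by (simp add: if_distrib cong: if_cong)
    finally show ?thesis .
  qed
  have \<pi>_id: "\<pi> w = w" if "w \<in> span W" for w
  proof -
    have "\<pi> b = id b" if "b \<in> W" for b
    proof -
      have "b \<in> Basis" using W that by auto
      then show ?thesis
        using that by - (rule euclidean_eqI, auto simp: \<pi>_inner inner_Basis)
    qed
    then have "\<pi> w = id w" by (rule linear_eq_on[OF lin linear_id that])
    then show ?thesis by simp
  qed
  have W_inner: "w \<bullet> b = 0" if "w \<in> span W" "b \<in> Basis - W" for w b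
    using \<pi>_inner[of b w] \<pi>_id[OF that(1)] that(2) by simp
  \<comment> \<open>A seminorm on the whole space: \<open>\<nu>\<close> transported to
    \<open>span W\<close>, blind to the remaining coordinates.\<close>
  define q where "q z = \<nu> (f (\<pi> z))" for z
  have fE: "f (\<pi> z) \<in> E" for z using f(2) \<pi>W by auto
  have linf: "linear (\<lambda>z. f (\<pi> z))" using linear_compose[OF lin f(1)] by (simp add: o_def)
  have q_cont: "continuous_on UNIV q"
    unfolding q_def by (rule continuous_on_norm_on_linear[OF \<nu> E linf]) (use fE in auto)
  \<comment> \<open>An open cylinder: the \<open>q\<close>-ball of radius \<open>r\<close> as base,
    times a cube of fixed size. The cube is centred at the origin because centres in
    \<open>span W\<close> have no other coordinates.\<close>
  define S where "S x r = {z. q (z - x) < r \<and> (\<forall>b\<in>Basis - W. \<bar>z \<bullet> b\<bar> < 1)}" for x r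
  have S_open: "open (S x r)" for x r
  proof -
    have "open {z. q (z - x) < r}"
      by (intro open_Collect_less continuous_on_compose2[OF q_cont] continuous_intros) auto
    moreover have "open {z. \<forall>b\<in>Basis - W. \<bar>z \<bullet> b\<bar> < 1}"
    proof -
      have "{z. \<forall>b\<in>Basis - W. \<bar>z \<bullet> b\<bar> < 1} = (\<Inter>b\<in>Basis - W. {z. \<bar>z \<bullet> b\<bar> < 1})" by auto
      also have "open \<dots>"
        by (intro open_INT finite_Diff finite_Basis ballI open_Collect_less continuous_intros)
      finally show ?thesis .
    qed
    ultimately show ?thesis unfolding S_def by (simp add: Collect_conj_eq open_Int)
  qed
  define V where "V = emeasure lborel (S 0 1)"
  have scaling: "emeasure lborel (S x r) = ennreal (r ^ dim E) * V" if "x \<in> span W" "0 < r" for x r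
  proof -
    \<comment> \<open>The map \<open>T\<close> stretches by \<open>r\<close> along \<open>W\<close>,
      shifts by \<open>x\<close> and leaves the other coordinates alone. The local \<open>c\<close>
      holds the stretching factors and is not the centre of the ball.\<close>
    define c where "c b = (if b \<in> W then r else 1)" for b
    define T where "T z = x + (\<Sum>b\<in>Basis. (c b * (z \<bullet> b)) *\<^sub>R b)" for z
    have T_inner: "T z \<bullet> b = x \<bullet> b + c b * (z \<bullet> b)" if "b \<in> Basis" for z b
      using that by (simp add: T_def inner_add_left)
    have "(\<Prod>b\<in>Basis. \<bar>c b\<bar>) = (\<Prod>b\<in>Basis. if b \<in> W then r else 1)"
      using \<open>0 < r\<close> by (intro prod.cong) (auto simp: c_def)
    also have "\<dots> = r ^ dim E"
      using W by (simp add: prod.If_cases Int_absorb1)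
    finally have c: "(\<Prod>b\<in>Basis. \<bar>c b\<bar>) = r ^ dim E" .
    have "\<pi> (T z - x) = r *\<^sub>R \<pi> z" for z
      by (auto simp: euclidean_eq_iff[where 'a='a] \<pi>_inner inner_diff_left T_inner c_def)
    then have "q (T z - x) = r * q z" for z
      using \<open>0 < r\<close> by (simp add: q_def linear_cmul f(1) norm_on_scaleR[OF \<nu> fE])
    moreover have "T z \<bullet> b = z \<bullet> b" if "b \<in> Basis - W" for z b
      using that T_inner[of b z] W_inner[OF \<open>x \<in> span W\<close> that] by (simp add: c_def)
    ultimately have "{z. T z \<in> S x r} = S 0 1"
      using \<open>0 < r\<close> by (auto simp: S_def)
    moreover have "emeasure lborel (S x r)
        = ennreal (\<Prod>b\<in>Basis. \<bar>c b\<bar>) * emeasure lborel {z. T z \<in> S x r}"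
      unfolding T_def using S_open[of x r] \<open>0 < r\<close>
      by (intro emeasure_lborel_affine_scaling) (auto simp: c_def)
    ultimately show ?thesis by (simp add: c V_def)
  qed
  have "0 \<in> S 0 1"
    using norm_on_eq_0_iff[OF \<nu>, of 0] subspace_0[OF E] linear_0[OF linf] by (simp add: S_def q_def)
  then have "\<not> negligible (S 0 1)" using open_not_negligible[OF S_open] by blast
  then have V_pos: "V \<noteq> 0"
    using null_sets_completionI[of "S 0 1" lborel] S_open[of 0 1]
    by (auto simp: V_def negligible_iff_null_sets null_sets_def)
  \<comment> \<open>\<open>V\<close> must be positive and finite to cancel from the volume
    comparison. The lower bound for \<open>\<nu>\<close> on \<open>span W\<close> bounds the base,
    the cube bounds the rest.\<close>
  have V_fin: "V < \<infinity>"
  proof -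
    have "inj_on f (span W)" using f(4) by (metis inj_onI)
    then obtain \<kappa> where \<kappa>: "0 < \<kappa>" "\<And>u. u \<in> span W \<Longrightarrow> \<kappa> * norm u \<le> \<nu> (f u)"
      using norm_on_linear_lower_bound[OF \<nu> E f(1) subspace_span, of W] f(2) by auto
    have "\<bar>z \<bullet> b\<bar> \<le> max 1 (1 / \<kappa>)" if z: "z \<in> S 0 1" and b: "b \<in> Basis" for z b
    proof (cases "b \<in> W")
      case True
      have "\<kappa> * norm (\<pi> z) \<le> 1" using \<kappa>(2)[OF \<pi>W, of z] z by (auto simp: S_def q_def)
      then have "norm (\<pi> z) \<le> 1 / \<kappa>" using \<kappa>(1) by (simp add: field_simps)
      moreover have "\<bar>z \<bullet> b\<bar> \<le> norm (\<pi> z)"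
        using Basis_le_norm[OF b, of "\<pi> z"] \<pi>_inner[OF b, of z] True by simp
      ultimately show ?thesis by linarith
    next
      case False
      then have "\<bar>z \<bullet> b\<bar> < 1" using z b by (auto simp: S_def)
      then show ?thesis by linarith
    qed
    then have "norm z \<le> (\<Sum>b\<in>(Basis :: 'a set). max 1 (1 / \<kappa>))" if "z \<in> S 0 1" for z
      using that by (intro order_trans[OF norm_le_l1] sum_mono)
    then have "bounded (S 0 1)" by (intro boundedI)
    then show ?thesis unfolding V_def by (rule emeasure_bounded_finite)
  qed
  \<comment> \<open>A common point would put two members of \<open>F\<close> at distance less than
    \<open>\<eta> / 2 + \<eta> / 2\<close>.\<close>
  have "disjoint_family_on (\<lambda>x. S (g x) (\<eta> / 2)) F"
    unfolding disjoint_family_on_def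
  proof (intro ballI impI, rule ccontr)
    fix x y assume xy: "x \<in> F" "y \<in> F" "x \<noteq> y" "S (g x) (\<eta> / 2) \<inter> S (g y) (\<eta> / 2) \<noteq> {}"
    then obtain z where z: "z \<in> S (g x) (\<eta> / 2)" "z \<in> S (g y) (\<eta> / 2)" by blast
    have xyE: "x \<in> E" "y \<in> E" using xy F by auto
    have eq: "f (\<pi> (z - g u)) = f (\<pi> z) - u" if "u \<in> E" for u
      using that f by (simp add: linear_diff lin \<pi>_id)
    have "\<nu> (f (\<pi> z) - x) < \<eta> / 2" "\<nu> (f (\<pi> z) - y) < \<eta> / 2"
      using z xyE by (auto simp: S_def q_def eq)
    moreover have "\<nu> (x - y) \<le> \<nu> (x - f (\<pi> z)) + \<nu> (f (\<pi> z) - y)"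
      using xyE fE by (intro norm_on_diff_triangle[OF \<nu> E]) auto
    moreover have "\<nu> (x - f (\<pi> z)) = \<nu> (f (\<pi> z) - x)"
      using xyE fE by (intro norm_on_minus_commute[OF \<nu> E]) auto
    ultimately show False using sep[OF xy(1-3)] by linarith
  qed
  then have "(\<Sum>x\<in>F. emeasure lborel (S (g x) (\<eta> / 2))) = emeasure lborel (\<Union>x\<in>F. S (g x) (\<eta> / 2))"
    using F(2) S_open by (intro sum_emeasure) auto
  \<comment> \<open>By the triangle inequality all cylinders lie in the one around
    \<open>g c\<close> whose radius is enlarged by \<open>\<eta> / 2\<close>.\<close>
  also have "\<dots> \<le> emeasure lborel (S (g c) (\<rho> + \<eta> / 2))"
  proof (intro emeasure_mono UN_least subsetI)
    fix x z assume x: "x \<in> F" and z: "z \<in> S (g x) (\<eta> / 2)"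
    have xE: "x \<in> E" using x F by auto
    have eq: "f (\<pi> (z - g u)) = f (\<pi> z) - u" if "u \<in> E" for u
      using that f by (simp add: linear_diff lin \<pi>_id)
    have "\<nu> (f (\<pi> z) - c) \<le> \<nu> (f (\<pi> z) - x) + \<nu> (x - c)"
      using xE fE c by (intro norm_on_diff_triangle[OF \<nu> E]) auto
    then show "z \<in> S (g c) (\<rho> + \<eta> / 2)"
      using z ball[OF x] xE c by (auto simp: S_def q_def eq)
  qed (use S_open in auto)
  finally have "of_nat (card F) * (ennreal ((\<eta> / 2) ^ dim E) * V)
      \<le> ennreal ((\<rho> + \<eta> / 2) ^ dim E) * V"
    using F f c \<eta> \<rho> by (simp add: scaling subset_iff cong: sum.cong)
  moreover obtain v where v: "V = ennreal v" "0 < v"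
    using V_pos V_fin by (cases V) (auto simp: less_le)
  ultimately have "real (card F) * ((\<eta> / 2) ^ dim E * v) \<le> (\<rho> + \<eta> / 2) ^ dim E * v"
    using \<eta> \<rho> by (simp add: ennreal_of_nat_eq_real_of_nat flip: ennreal_mult)
  then have "real (card F) * (\<eta> / 2) ^ dim E \<le> (\<rho> + \<eta> / 2) ^ dim E"
    using v(2) by (simp flip: mult.assoc)
  then have "real (card F) \<le> ((\<rho> + \<eta> / 2) / (\<eta> / 2)) ^ dim E"
    using \<eta> by (subst power_divide, subst pos_le_divide_eq) auto
  also have "(\<rho> + \<eta> / 2) / (\<eta> / 2) = 1 + 2 * \<rho> / \<eta>" using \<eta> by (simp add: field_simps)
  finally show ?thesis .
qed

text \<open>Twice the radius is replaced by the diameter. In a nonzero space, antipodal points at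
  distance just below \<open>\<rho>\<close> from the centre show \<open>2 * \<rho> \<le> D\<close>.
  In the zero space \<open>\<rho>\<close> is arbitrary, but \<open>F\<close> has at most one
  point.\<close>

lemma packing_bound_norm_ball:
  fixes E :: "'a::euclidean_space set"
  assumes E: "subspace E" and \<nu>: "norm_on E \<nu>" and B: "norm_ball E \<nu> B"
    and D: "norm_diameter \<nu> B = ereal D" "0 \<le> D" and F: "F \<subseteq> B" "finite F" and \<eta>: "0 < \<eta>"
    and sep: "\<And>x y. x \<in> F \<Longrightarrow> y \<in> F \<Longrightarrow> x \<noteq> y \<Longrightarrow> \<eta> \<le> \<nu> (x - y)"
  shows "real (card F) \<le> (1 + D / \<eta>) ^ dim E"
proof -
  \<comment> \<open>Open and closed balls are treated together through these two inclusions.\<close>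
  obtain c \<rho> where c: "c \<in> E" "0 \<le> \<rho>" "B \<subseteq> {u\<in>E. \<nu> (u - c) \<le> \<rho>}" "{u\<in>E. \<nu> (u - c) < \<rho>} \<subseteq> B"
    using B unfolding norm_ball_def
  proof (elim bexE disjE exE conjE)
    fix c \<rho>
    assume "c \<in> E" "0 \<le> \<rho>" "B = {u\<in>E. \<nu> (u - c) \<le> \<rho>}"
    then show ?thesis by (intro that[of c \<rho>]) auto
  next
    fix c \<rho>
    assume "c \<in> E" "0 < \<rho>" "B = {u\<in>E. \<nu> (u - c) < \<rho>}"
    then show ?thesis by (intro that[of c \<rho>]) auto
  qed
  show ?thesis
  proof (cases "E \<subseteq> {0}")
    case True
    then have "F \<subseteq> {0}" using F c by auto
    then have "card F \<le> 1" using card_mono[of "{0}" F] by simp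
    moreover have "(1 + D / \<eta>) ^ dim E = 1" using True by (simp add: dim_eq_0[THEN iffD2])
    ultimately show ?thesis by simp
  next
    case False
    then obtain e where e: "e \<in> E" "e \<noteq> 0" by auto
    then have \<nu>e: "0 < \<nu> e"
      using norm_on_nonneg[OF \<nu>] norm_on_eq_0_iff[OF \<nu>] by (simp add: less_le)
    have half: "2 * s \<le> D" if s: "0 \<le> s" "s < \<rho>" for s
    proof -
      have "c + (s / \<nu> e) *\<^sub>R e \<in> B" "c - (s / \<nu> e) *\<^sub>R e \<in> B"
        using c e s \<nu>e norm_on_scaleR[OF \<nu> e(1), of "s / \<nu> e"] norm_on_scaleR[OF \<nu> e(1), of "- (s / \<nu> e)"]
        by (auto intro!: subsetD[OF c(4)] simp: subspace_add subspace_diff subspace_scale E)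
      then have "ereal (\<nu> (c + (s / \<nu> e) *\<^sub>R e - (c - (s / \<nu> e) *\<^sub>R e))) \<le> norm_diameter \<nu> B"
        unfolding norm_diameter_def by (intro SUP_upper2[of "(c + (s / \<nu> e) *\<^sub>R e, c - (s / \<nu> e) *\<^sub>R e)"]) auto
      moreover have "c + (s / \<nu> e) *\<^sub>R e - (c - (s / \<nu> e) *\<^sub>R e) = (2 * s / \<nu> e) *\<^sub>R e"
        by (simp add: algebra_simps flip: scaleR_add_left)
      ultimately show ?thesis
        using D e \<nu>e s by (simp add: norm_on_scaleR[OF \<nu>])
    qed
    have "2 * \<rho> \<le> D"
    proof (rule ccontr)
      assume "\<not> 2 * \<rho> \<le> D"
      then have "D / 2 < \<rho>" by simp
      then obtain s where "D / 2 < s" "s < \<rho>" using dense by blast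
      then show False using half[of s] D(2) by linarith
    qed
    have "real (card F) \<le> (1 + 2 * \<rho> / \<eta>) ^ dim E"
      using c F by (intro packing_bound[OF E \<nu> _ F(2) c(1) _ c(2) \<eta> sep]) auto
    also have "\<dots> \<le> (1 + D / \<eta>) ^ dim E"
      using \<open>2 * \<rho> \<le> D\<close> \<eta> c(2) by (intro power_mono add_left_mono divide_right_mono) auto
    finally show ?thesis .
  qed
qed

section \<open>Exactness of norm penalties for convex problems\<close>

text \<open>Exact penalization by separation: \<open>S\<close>, in the role of a convex epigraph,
  lies above the concave function \<open>p - \<sigma> * \<nu> (u - z)\<close>. The slope of a
  hyperplane between the two yields the multiplier.\<close>

lemma norm_penalty_multiplier:
  fixes E :: "'a::euclidean_space set" and S :: "('a \<times> real) set"
  assumes E: "subspace E" and \<nu>: "norm_on E \<nu>" and u: "u \<in> E" and \<sigma>: "0 \<le> \<sigma>"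
    and S: "convex S" "S \<noteq> {}" "\<And>z r. (z, r) \<in> S \<Longrightarrow> z \<in> E"
    and p: "\<And>z r. (z, r) \<in> S \<Longrightarrow> p \<le> r + \<sigma> * \<nu> (u - z)"
  obtains l where "l \<in> E" "dual_norm_on E \<nu> l \<le> \<sigma>" "\<And>z r. (z, r) \<in> S \<Longrightarrow> p \<le> r + l \<bullet> (u - z)"
proof -
  obtain g where g: "linear g" "range g \<subseteq> E" "\<And>u. u \<in> E \<Longrightarrow> g u = u"
    using linear_retraction_subspace[OF E] by blast
  have gE: "g z \<in> E" for z using g(2) by auto
  \<comment> \<open>The strict hypograph, with the penalty extended beyond \<open>E\<close> by the
    retraction. It has points over every \<open>z\<close>, which will exclude a vertical
    hyperplane.\<close>
  define H where "H = {(z, r). r < p - \<sigma> * \<nu> (g (u - z))}"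
  have "convex H"
  proof (rule convexI)
    fix w w' :: "'a \<times> real" and a b :: real
    assume H: "w \<in> H" "w' \<in> H" and ab: "0 \<le> a" "0 \<le> b" "a + b = 1"
    obtain z r z' r' where w: "w = (z, r)" "w' = (z', r')" by fastforce
    have "u = a *\<^sub>R u + b *\<^sub>R u" by (simp add: ab flip: scaleR_add_left)
    then have "u - (a *\<^sub>R z + b *\<^sub>R z') = a *\<^sub>R (u - z) + b *\<^sub>R (u - z')"
      by (simp add: scaleR_diff_right)
    then have "\<nu> (g (u - (a *\<^sub>R z + b *\<^sub>R z'))) \<le> \<nu> (a *\<^sub>R g (u - z)) + \<nu> (b *\<^sub>R g (u - z'))"
      using norm_on_triangle[OF \<nu>] gE E
      by (simp add: linear_add[OF g(1)] linear_cmul[OF g(1)] subspace_scale)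
    also have "\<dots> = a * \<nu> (g (u - z)) + b * \<nu> (g (u - z'))"
      using ab by (simp add: norm_on_scaleR[OF \<nu> gE])
    finally have *: "\<sigma> * \<nu> (g (u - (a *\<^sub>R z + b *\<^sub>R z')))
        \<le> \<sigma> * (a * \<nu> (g (u - z)) + b * \<nu> (g (u - z')))"
      by (rule mult_left_mono[OF _ \<sigma>])
    have "a * r + b * r' < a * (p - \<sigma> * \<nu> (g (u - z))) + b * (p - \<sigma> * \<nu> (g (u - z')))"
    proof (cases "a = 0")
      case True
      then show ?thesis using H ab by (simp add: H_def w)
    next
      case False
      then show ?thesis
        using H ab by (intro add_less_le_mono mult_strict_left_mono mult_left_mono) (auto simp: H_def w)
    qed
    also have "\<dots> = (a + b) * p - \<sigma> * (a * \<nu> (g (u - z)) + b * \<nu> (g (u - z')))"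
      by (simp add: algebra_simps)
    finally show "a *\<^sub>R w + b *\<^sub>R w' \<in> H" using * ab by (simp add: H_def w)
  qed
  moreover have "(u, p - 1) \<in> H"
    using norm_on_eq_0_iff[OF \<nu>, of 0] subspace_0[OF E] by (simp add: H_def linear_0[OF g(1)])
  moreover have "S \<inter> H = {}"
  proof -
    have "g (u - z) = u - z" if "(z, r) \<in> S" for z r
      using S(3)[OF that] u E by (intro g) (simp add: subspace_diff)
    then show ?thesis using p by (fastforce simp: H_def)
  qed
  ultimately obtain w b where w: "w \<noteq> 0" "\<And>v. v \<in> S \<Longrightarrow> w \<bullet> v \<le> b" "\<And>v. v \<in> H \<Longrightarrow> b \<le> w \<bullet> v"
    using separating_hyperplane_sets[of S H] S(1,2) by blast
  obtain \<alpha> \<beta> where ab: "w = (\<alpha>, \<beta>)" by fastforce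
  have Hb: "b \<le> \<alpha> \<bullet> z + \<beta> * r" if "r < p - \<sigma> * \<nu> (g (u - z))" for z r
    using w(3)[of "(z, r)"] that by (simp add: H_def ab)
  \<comment> \<open>If \<open>\<beta>\<close> were positive, \<open>r\<close> could be sent to minus
    infinity in \<open>H\<close>. If it were zero, the nonzero functional \<open>\<alpha>\<close>
    would be bounded below on the whole space.\<close>
  have "\<beta> < 0"
  proof (rule ccontr)
    assume "\<not> \<beta> < 0"
    moreover have "\<not> \<beta> > 0"
    proof
      assume "\<beta> > 0"
      define r where "r = min (p - \<sigma> * \<nu> (g (u - u)) - 1) ((b - \<alpha> \<bullet> u) / \<beta> - 1)"
      have "\<beta> * r \<le> \<beta> * ((b - \<alpha> \<bullet> u) / \<beta> - 1)"
        using \<open>\<beta> > 0\<close> by (intro mult_left_mono) (auto simp: r_def)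
      also have "\<dots> < b - \<alpha> \<bullet> u" using \<open>\<beta> > 0\<close> by (simp add: field_simps)
      finally have "\<alpha> \<bullet> u + \<beta> * r < b" by simp
      moreover have "r < p - \<sigma> * \<nu> (g (u - u))" by (simp add: r_def min_def)
      ultimately show False using Hb by fastforce
    qed
    ultimately have "\<beta> = 0" by simp
    then have "\<alpha> \<noteq> 0" using w(1) ab by (auto simp: zero_prod_def)
    define z where "z = ((b - 1) / (\<alpha> \<bullet> \<alpha>)) *\<^sub>R \<alpha>"
    have "\<alpha> \<bullet> z = b - 1" using \<open>\<alpha> \<noteq> 0\<close> by (simp add: z_def)
    then show False using Hb[of "p - \<sigma> * \<nu> (g (u - z)) - 1" z] \<open>\<beta> = 0\<close> by simp
  qed
  define k where "k = - \<beta>"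
  have k: "0 < k" using \<open>\<beta> < 0\<close> by (simp add: k_def)
  \<comment> \<open>Here \<open>r\<close> has been moved up to the boundary of
    \<open>H\<close>.\<close>
  have Hb': "b \<le> \<alpha> \<bullet> z - k * (p - \<sigma> * \<nu> (g (u - z)))" for z
  proof (rule ccontr)
    assume "\<not> ?thesis"
    then have "(\<alpha> \<bullet> z - b) / k < p - \<sigma> * \<nu> (g (u - z))" using k by (simp add: field_simps)
    then obtain r where r: "(\<alpha> \<bullet> z - b) / k < r" "r < p - \<sigma> * \<nu> (g (u - z))" using dense by blast
    from r(1) have "\<alpha> \<bullet> z - b < k * r" using k by (simp add: field_simps)
    then show False using Hb[OF r(2)] by (simp add: k_def)
  qed
  \<comment> \<open>Otherwise moving from \<open>u\<close> along \<open>- d\<close> decreases the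
    right side of \<open>Hb'\<close> at rate \<open>e\<close>, and the step length
    \<open>M / e\<close> takes it below \<open>b\<close>.\<close>
  have dom: "\<alpha> \<bullet> d \<le> k * (\<sigma> * \<nu> d)" if d: "d \<in> E" for d
  proof (rule ccontr)
    define e where "e = \<alpha> \<bullet> d - k * (\<sigma> * \<nu> d)"
    assume "\<not> ?thesis"
    then have e: "0 < e" by (simp add: e_def)
    define M where "M = \<bar>\<alpha> \<bullet> u - k * p - b\<bar> + 1"
    define t where "t = M / e"
    have t: "0 < t" "t * e = M" using e by (auto simp: t_def M_def)
    have "g (t *\<^sub>R d) = t *\<^sub>R d" using d E by (intro g) (simp add: subspace_scale)
    then have "b \<le> \<alpha> \<bullet> (u - t *\<^sub>R d) - k * (p - \<sigma> * (t * \<nu> d))"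
      using Hb'[of "u - t *\<^sub>R d"] t norm_on_scaleR[OF \<nu> d, of t] by simp
    also have "\<dots> = \<alpha> \<bullet> u - k * p - t * e"
      by (simp add: e_def inner_diff_right algebra_simps)
    finally show False using t(2) by (simp add: M_def)
  qed
  \<comment> \<open>Division by \<open>k\<close> normalises the hyperplane. The part orthogonal to
    \<open>E\<close> vanishes on all differences \<open>u - z\<close> and is dropped, so that the
    multiplier lies in \<open>E\<close>.\<close>
  obtain l0 l1 where l: "\<alpha> /\<^sub>R k = l0 + l1" "l0 \<in> E" "\<And>d. d \<in> E \<Longrightarrow> l1 \<bullet> d = 0"
    using orthogonal_subspace_decomp_exists[of E "\<alpha> /\<^sub>R k"] E
    by (metis orthogonal_def span_eq_iff)
  have l0: "k * (l0 \<bullet> d) = \<alpha> \<bullet> d" if "d \<in> E" for d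
  proof -
    have "l0 \<bullet> d = (\<alpha> /\<^sub>R k) \<bullet> d" using l(3)[OF that] by (simp add: l(1) inner_add_left)
    then show ?thesis using k by simp
  qed
  show ?thesis
  proof
    show "l0 \<in> E" by (rule l)
    have "l0 \<bullet> d \<le> \<sigma> * \<nu> d" if "d \<in> E" for d
    proof -
      have "k * (l0 \<bullet> d) \<le> k * (\<sigma> * \<nu> d)" using dom[OF that] l0[OF that] by simp
      then show ?thesis using k by simp
    qed
    then show "dual_norm_on E \<nu> l0 \<le> \<sigma>" by (intro dual_norm_on_le[OF \<nu> E \<sigma>])
    fix z r assume zr: "(z, r) \<in> S"
    have "\<nu> (g 0) = 0"
      using norm_on_eq_0_iff[OF \<nu>, of 0] subspace_0[OF E] by (simp add: linear_0[OF g(1)])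
    then have "b \<le> \<alpha> \<bullet> u - k * p" using Hb'[of u] by simp
    moreover have "\<alpha> \<bullet> z - k * r \<le> b" using w(2)[OF zr] by (simp add: ab k_def)
    moreover have "\<alpha> \<bullet> u - \<alpha> \<bullet> z = k * (l0 \<bullet> (u - z))"
      using l0[of "u - z"] S(3)[OF zr] u E by (simp add: subspace_diff inner_diff_right)
    ultimately have "k * p \<le> k * (r + l0 \<bullet> (u - z))" by (simp add: algebra_simps)
    then show "p \<le> r + l0 \<bullet> (u - z)" using k by simp
  qed
qed

section \<open>Approximations along a run\<close>

lemma finite_tree:
  assumes "\<And>t. t \<le> horizon P \<Longrightarrow> finite (nodes P t)"
  shows "finite (tree P)"
proof (rule finite_subset)
  show "tree P \<subseteq> {n. set n \<subseteq> (\<Union>t\<le>horizon P. nodes P t) \<and> length n \<le> horizon P}"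
    by (fastforce simp: tree_def in_set_conv_nth)
  show "finite {n. set n \<subseteq> (\<Union>t\<le>horizon P. nodes P t) \<and> length n \<le> horizon P}"
    using assms by (intro finite_lists_length_le) auto
qed

text \<open>The Fenchel-Young inequality, by cases on infinite values. It keeps the convex update of
  the upper approximation below both of its pieces.\<close>

lemma biconjugate_on_le:
  assumes "x \<in> E"
  shows "biconjugate_on E g x \<le> g x"
proof -
  have "ereal (x \<bullet> s) - conjugate_on E g s \<le> g x" for s
  proof -
    have "ereal (s \<bullet> x) - g x \<le> conjugate_on E g s"
      unfolding conjugate_on_def using assms by (intro SUP_upper)
    then show ?thesis
      by (cases "g x"; cases "conjugate_on E g s") (auto simp: inner_commute)
  qed
  then show ?thesis
    unfolding biconjugate_on_def conjugate_on_def[of E "conjugate_on E g"] by (rule SUP_least)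
qed

locale ddp_run =
  fixes P :: "('n, 'a::euclidean_space, 'b::euclidean_space) msp"
    and R :: "('n, 'a, 'b) ddp_trace"
    and \<epsilon> :: real and N :: nat
  assumes program: "msp_program P" and feasible: "finite_feasible P"
    and penalties: "msp_penalties P" and dual_bounds: "msp_dual_bounds P"
    and run: "ddp_terminates_in P \<epsilon> R N"
begin

section \<open>Consequences of the assumptions on the program\<close>

lemma horizon_pos: "1 \<le> horizon P"
  using program by (simp add: msp_program_def)

lemma nodes_0: "nodes P 0 = {root P}"
  using program by (simp add: msp_program_def)

lemma finite_nodes: "t \<le> horizon P \<Longrightarrow> finite (nodes P t)"
  using program by (simp add: msp_program_def)

lemma trans_pos: "t < horizon P \<Longrightarrow> m \<in> nodes P (Suc t) \<Longrightarrow> 0 < trans P t m"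
  using program by (simp add: msp_program_def)

lemma sum_trans: "t < horizon P \<Longrightarrow> (\<Sum>m\<in>nodes P (Suc t). trans P t m) = 1"
  using program by (simp add: msp_program_def)

lemma subspace_sspace: "t < horizon P \<Longrightarrow> subspace (sspace P t)"
  using program by (simp add: msp_program_def)

lemma norm_on_snorm: "t < horizon P \<Longrightarrow> norm_on (sspace P t) (snorm P t)"
  using program by (simp add: msp_program_def)

lemma states_sspace: "t < horizon P \<Longrightarrow> x \<in> states P t \<Longrightarrow> x \<in> sspace P t"
  using program by (auto simp: msp_program_def)

lemma fst_feas: "t < horizon P \<Longrightarrow> m \<in> nodes P t \<Longrightarrow> fst ` feas P m = states P t"
  using program by (auto simp: msp_program_def)

lemma stagecost_nonneg:
  assumes "t \<le> horizon P" "m \<in> nodes P t" "z \<in> prev_states P t" "(x, y) \<in> feas P m"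
  shows "0 \<le> stagecost P m z y x"
  using program assms unfolding msp_program_def by fastforce

lemma nodes_nonempty: "t \<le> horizon P \<Longrightarrow> nodes P t \<noteq> {}"
  using nodes_0 sum_trans[of "t - 1"] by (cases t) auto

lemma pcoef_pos: "t \<le> horizon P \<Longrightarrow> m \<in> nodes P t \<Longrightarrow> 0 < pcoef P m"
  using penalties by (auto simp: msp_penalties_def)

lemma pen_nonneg:
  assumes "t < horizon P" "m \<in> nodes P (Suc t)" "u \<in> sspace P t"
  shows "0 \<le> pen P m u"
proof -
  have "penalty_on (prev_space P (Suc t)) (snorm P (Suc t - 1)) (pen P m)"
    using penalties assms unfolding msp_penalties_def by (meson Suc_leI)
  then show ?thesis using assms by (simp add: penalty_on_def prev_space_def)
qed

text \<open>The Lipschitz condition is applied against the zero difference \<open>x' - x'\<close>,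
  where the penalty vanishes.\<close>

lemma pen_le_snorm:
  assumes "t < horizon P" "m \<in> nodes P (Suc t)" "x \<in> states P t" "x' \<in> states P t"
  shows "pen P m (x - x') \<le> snorm P t (x - x')"
proof -
  have "penalty_on (prev_space P (Suc t)) (snorm P (Suc t - 1)) (pen P m)"
    and lip: "\<forall>u\<in>{v - w |v w. v \<in> prev_states P (Suc t) \<and> w \<in> prev_states P (Suc t)}.
         \<forall>u'\<in>{v - w |v w. v \<in> prev_states P (Suc t) \<and> w \<in> prev_states P (Suc t)}.
           \<bar>pen P m u - pen P m u'\<bar> \<le> snorm P (Suc t - 1) (u - u')"
    using penalties assms unfolding msp_penalties_def by (meson Suc_leI)+
  then have "pen P m 0 = 0"
    using subspace_0[OF subspace_sspace[OF assms(1)]] by (simp add: penalty_on_def prev_space_def)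
  moreover have "\<bar>pen P m (x - x') - pen P m (x' - x')\<bar> \<le> snorm P t (x - x' - (x' - x'))"
    using bspec[OF bspec[OF lip, of "x - x'"], of "x' - x'"] assms
    by (simp add: prev_states_def) blast
  ultimately show ?thesis by simp
qed

lemma bounds_nonneg:
  assumes "t < horizon P" "m \<in> nodes P (Suc t)"
  shows "0 \<le> lbnd P m" "0 \<le> rbnd P m"
  using dual_bounds assms by (auto simp: msp_dual_bounds_def Ball_def dest: spec[of _ "Suc t"])

lemma bounds_convex:
  assumes "t < horizon P" "m \<in> nodes P (Suc t)" "convex_problem P \<and> norm_penalties P"
  shows "pcoef P m \<le> lbnd P m" "rbnd P m = 0"
  using dual_bounds assms by (auto simp: msp_dual_bounds_def Ball_def dest: spec[of _ "Suc t"])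

lemma bounds_nonconvex:
  assumes "t < horizon P" "m \<in> nodes P (Suc t)" "\<not> (convex_problem P \<and> norm_penalties P)"
  shows "pcoef P m \<le> rbnd P m"
  using dual_bounds assms by (auto simp: msp_dual_bounds_def Ball_def dest: spec[of _ "Suc t"])

text \<open>Both alternatives for the dual bounds give this. It makes \<open>lip_const\<close>
  positive and lets it bound the slopes of the upper pieces too.\<close>

lemma pcoef_le_bounds:
  assumes "t < horizon P" "m \<in> nodes P (Suc t)"
  shows "pcoef P m \<le> lbnd P m + rbnd P m"
  using bounds_nonneg[OF assms] bounds_convex[OF assms] bounds_nonconvex[OF assms] by force

lemma lip_const_pos:
  assumes "t < horizon P"
  shows "0 < lip_const P t"
proof -
  have "0 < trans P t m * (lbnd P m + rbnd P m)" if "m \<in> nodes P (Suc t)" for m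
    using trans_pos[OF assms that] pcoef_le_bounds[OF assms that] pcoef_pos[of "Suc t" m] assms that
    by (intro mult_pos_pos) auto
  then show ?thesis
    unfolding lip_const_def using assms finite_nodes[of "Suc t"] nodes_nonempty[of "Suc t"]
    by (intro sum_pos) auto
qed

text \<open>
  Every node carries positive probability in the scenario tree, so a feasible solution of finite
  objective has finite cost at every node.
\<close>

lemma finite_stagecost:
  assumes "t \<le> horizon P" "m \<in> nodes P t"
  obtains x y z where "z \<in> prev_states P t" "(x, y) \<in> feas P m" "stagecost P m z y x < \<infinity>"
proof -
  obtain X Y where XY: "tree_feasible P X Y" "tree_cost P X Y < \<infinity>"
    using feasible by (auto simp: finite_feasible_def)
  define c where "c n = ereal (tree_prob P n) *
      stagecost P (tree_data P n) (parent_state X n) (Y n) (X n)" for n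
  have data: "tree_data P n \<in> nodes P (length n)" if "n \<in> tree P" for n
    using that nodes_0 by (cases n rule: rev_cases) (auto simp: tree_def tree_data_def)
  have len: "length n \<le> horizon P" if "n \<in> tree P" for n
    using that by (simp add: tree_def)
  have feas: "(X n, Y n) \<in> feas P (tree_data P n)" if "n \<in> tree P" for n
    using XY(1) that by (simp add: tree_feasible_def)
  have parent: "parent_state X n \<in> prev_states P (length n)" if n: "n \<in> tree P" for n
  proof (cases n rule: rev_cases)
    case Nil
    then show ?thesis by (simp add: parent_state_def prev_states_def)
  next
    case (snoc n' k)
    have "n' \<in> tree P" using n unfolding snoc tree_def
      by (auto simp: nth_append split: if_splits)
    moreover have "length n' < horizon P" using len[OF n] by (simp add: snoc)
    ultimately have "X n' \<in> states P (length n')"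
      using feas[of n'] data[of n'] fst_feas[of "length n'" "tree_data P n'"] by force
    then show ?thesis by (simp add: snoc parent_state_def prev_states_def)
  qed
  have prob: "0 < tree_prob P n" if "n \<in> tree P" for n
    using that trans_pos by (fastforce simp: tree_prob_def tree_def intro: prod_pos)
  have nonneg: "0 \<le> c n" if "n \<in> tree P" for n
    unfolding c_def using prob[OF that] stagecost_nonneg[OF len data parent feas, OF that that that that]
    by (simp add: ereal_zero_le_0_iff)
  define h where "h s = (SOME m. m \<in> nodes P s)" for s
  have h: "h s \<in> nodes P s" if "s \<le> horizon P" for s
    unfolding h_def by (rule some_in_eq[THEN iffD2, OF nodes_nonempty[OF that]])
  \<comment> \<open>A path of length \<open>t\<close> ending in \<open>m\<close>, with arbitrary
    earlier nodes; for \<open>t = 0\<close> it is the root.\<close>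
  define n where "n = map (\<lambda>s. if Suc s = t then m else h (Suc s)) [0..<t]"
  have n: "n \<in> tree P"
    using assms h by (auto simp: tree_def n_def)
  have len_n: "length n = t" by (simp add: n_def)
  have data_n: "tree_data P n = m"
    using assms nodes_0 by (cases t) (auto simp: tree_data_def n_def)
  have "finite (tree P)" by (rule finite_tree) (rule finite_nodes)
  then have "sum c {n} \<le> sum c (tree P)" using n nonneg by (intro sum_mono2) auto
  then have "c n \<le> sum c (tree P)" by simp
  also have "\<dots> < \<infinity>" using XY(2) by (simp add: tree_cost_def c_def)
  finally have "stagecost P m (parent_state X n) (Y n) (X n) < \<infinity>"
    using prob[OF n] by (auto simp: c_def data_n)
  then show ?thesis
    using that[of "parent_state X n" "X n" "Y n"] parent[OF n] feas[OF n] by (simp add: len_n data_n)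
qed

section \<open>Feasibility and optimality of the iterates\<close>

lemma init: "ddp_init P R"
  using run by (simp add: ddp_terminates_in_def)

lemma forward: "i \<in> {1..N} \<Longrightarrow> ddp_forward P R i"
  using run by (simp add: ddp_terminates_in_def)

lemma backward: "i \<in> {1..N} \<Longrightarrow> ddp_backward P R i"
  using run by (simp add: ddp_terminates_in_def)

lemma root: "i \<in> {1..N} \<Longrightarrow> ddp_root P R i"
  using run by (simp add: ddp_terminates_in_def)

lemma under_step:
  assumes "i \<in> {1..N}" "t < horizon P"
  shows "under R i t = update_under P R i t"
  using backward[OF assms(1)] root[OF assms(1)] assms(2)
  by (cases t) (auto simp: ddp_backward_def ddp_root_def)

lemma over_step:
  assumes "i \<in> {1..N}" "t < horizon P"
  shows "over R i t = update_over P R i t"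
  using backward[OF assms(1)] root[OF assms(1)] assms(2)
  by (cases t) (auto simp: ddp_backward_def ddp_root_def)

lemma under_horizon: "under R i (horizon P) = (\<lambda>x. 0)"
  and over_horizon: "over R i (horizon P) = (\<lambda>x. 0)"
  using init by (auto simp: ddp_init_def)

lemma sol_optimal:
  assumes "i \<in> {1..N}" "t < horizon P" "m \<in> nodes P (Suc t)"
  shows "sol R i m \<in> node_feas P (Suc t) m"
    and "w \<in> node_feas P (Suc t) m \<Longrightarrow>
      node_cost P m (under R (i - 1) (Suc t)) (state R i t) (sol R i m)
        \<le> node_cost P m (under R (i - 1) (Suc t)) (state R i t) w"
proof -
  have "is_arg_min (node_cost P m (under R (i - 1) (Suc t)) (state R i t))
      (\<lambda>w. w \<in> node_feas P (Suc t) m) (sol R i m)"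
    using bspec[OF forward[OF assms(1), unfolded ddp_forward_def], of "Suc t"] assms(2,3) by simp
  then show "sol R i m \<in> node_feas P (Suc t) m"
    and "w \<in> node_feas P (Suc t) m \<Longrightarrow>
      node_cost P m (under R (i - 1) (Suc t)) (state R i t) (sol R i m)
        \<le> node_cost P m (under R (i - 1) (Suc t)) (state R i t) w"
    unfolding is_arg_min_linorder by blast+
qed

lemma mult_optimal:
  assumes "i \<in> {1..N}" "t < horizon P" "m \<in> nodes P (Suc t)"
  shows "mult R i m \<in> dual_feas P (Suc t) m"
    and "low_val P R i (Suc t) m =
      dual_inner P (Suc t) m (under R i (Suc t)) (state R i t) (mult R i m)"
proof -
  have *: "is_arg_max (dual_inner P (Suc t) m (under R i (Suc t)) (state R i t))
             (\<lambda>w. w \<in> dual_feas P (Suc t) m) (mult R i m)"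
    using bspec[OF backward[OF assms(1), unfolded ddp_backward_def], of "Suc t"] assms(2,3) by simp
  then show mem: "mult R i m \<in> dual_feas P (Suc t) m" by (simp add: is_arg_max_linorder)
  from * have opt: "dual_inner P (Suc t) m (under R i (Suc t)) (state R i t) w
      \<le> dual_inner P (Suc t) m (under R i (Suc t)) (state R i t) (mult R i m)"
    if "w \<in> dual_feas P (Suc t) m" for w
    using that unfolding is_arg_max_linorder by blast
  show "low_val P R i (Suc t) m =
      dual_inner P (Suc t) m (under R i (Suc t)) (state R i t) (mult R i m)"
    unfolding low_val_def dual_value_def diff_Suc_1
    using opt by (intro antisym[OF SUP_least SUP_upper[OF mem]])
qed

lemma root_in_feas:
  assumes "i \<in> {1..N}"
  shows "(state R i 0, root_y R i) \<in> feas P (root P)"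
\<comment> \<open>The root decision used in iteration \<open>i\<close> is found beforehand: by the
  initialization, or at the end of iteration \<open>i - 1\<close>.\<close>
proof (cases "i = 1")
  case True
  then show ?thesis using init by (simp add: ddp_init_def is_arg_min_def)
next
  case False
  then have "i - 1 \<in> {1..N}" "i - 1 + 1 = i" using assms by auto
  then show ?thesis using root[of "i - 1"] by (simp add: ddp_root_def is_arg_min_def)
qed

lemma state_in_states:
  assumes "i \<in> {1..N}" "t < horizon P"
  shows "state R i t \<in> states P t"
proof (cases t)
  case 0
  then show ?thesis
    using root_in_feas[OF assms(1)] fst_feas[of 0 "root P"] nodes_0 assms(2) by force
next
  case (Suc s)
  then obtain n where n: "n \<in> nodes P t" "state R i t = sol_x R i n"
    using forward[OF assms(1)] assms(2) by (auto simp: ddp_forward_def is_arg_max_linorder)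
  have "fst (sol R i n) \<in> feas P n"
    using sol_optimal(1)[of i s n] n(1) Suc assms by (auto simp: node_feas_def)
  then show ?thesis
    using fst_feas[OF assms(2) n(1)] n(2) by (auto simp: sol_x_def)
qed

text \<open>Used with \<open>\<rho> = 0\<close> to see that dual values are nonnegative, and with
  \<open>\<rho> = pcoef P m\<close> to recover the penalized node problem.\<close>

lemma dual_zero_feas:
  assumes "t < horizon P" "m \<in> nodes P (Suc t)" "0 \<le> \<rho>" "\<rho> \<le> rbnd P m"
  shows "(0, \<rho>) \<in> dual_feas P (Suc t) m"
proof -
  have "dual_norm_on (sspace P t) (snorm P t) 0 \<le> lbnd P m"
    using bounds_nonneg[OF assms(1,2)] norm_on_snorm[OF assms(1)] subspace_sspace[OF assms(1)]
    by (intro dual_norm_on_le) (auto intro: mult_nonneg_nonneg norm_on_nonneg)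
  then show ?thesis
    using assms subspace_0[OF subspace_sspace[OF assms(1)]] by (simp add: dual_feas_def prev_space_def)
qed

section \<open>Finiteness, convexity and persistence of the approximations\<close>

text \<open>The multiplier \<open>(0, 0)\<close> gives the lower bound 0. A decision of finite stage
  cost, tested at the optimal multiplier, gives a finite upper bound.\<close>

lemma low_val_real:
  assumes i: "i \<in> {1..N}" and t: "t < horizon P" and m: "m \<in> nodes P (Suc t)"
    and g: "under R i (Suc t) = (\<lambda>x. ereal (g x))" "\<And>x. 0 \<le> g x"
  obtains c where "low_val P R i (Suc t) m = ereal c"
proof -
  have "0 \<le> dual_inner P (Suc t) m (under R i (Suc t)) (state R i t) (0, 0)"
    unfolding dual_inner_def using stagecost_nonneg[OF _ m] t g(2)
    by (auto simp: node_feas_def g(1) intro!: INF_greatest add_nonneg_nonneg)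
  also have "\<dots> \<le> low_val P R i (Suc t) m"
    unfolding low_val_def dual_value_def
    using dual_zero_feas[OF t m order_refl] bounds_nonneg[OF t m] by (intro SUP_upper2) auto
  finally have "0 \<le> low_val P R i (Suc t) m" .
  moreover obtain x y z where xyz: "z \<in> prev_states P (Suc t)" "(x, y) \<in> feas P m"
      "stagecost P m z y x < \<infinity>"
    using finite_stagecost[OF _ m] t by (metis Suc_leI)
  obtain l \<rho> where l: "mult R i m = (l, \<rho>)" by fastforce
  have "low_val P R i (Suc t) m \<le> stagecost P m z y x +
      ereal (l \<bullet> (state R i t - z) + \<rho> * pen P m (state R i t - z)) + ereal (g x)"
    unfolding mult_optimal(2)[OF i t m] dual_inner_def l using xyz(1,2)
    by (auto simp: node_feas_def g(1) intro!: INF_lower2[of "((x, y), z)"])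
  then have "low_val P R i (Suc t) m \<noteq> \<infinity>" using xyz(3) by auto
  ultimately show ?thesis using that by (cases "low_val P R i (Suc t) m") auto
qed

text \<open>The new approximation at \<open>t\<close> depends on the old one at \<open>t\<close> and
  the new one at \<open>t + 1\<close>, so the induction goes forward in \<open>i\<close> and,
  inside, backward in \<open>t\<close>. In the convex case with norm penalties,
  \<open>\<rho> = 0\<close> makes the cuts affine, which preserves convexity.\<close>

lemma under_real:
  assumes "i \<le> N" "t \<le> horizon P"
  obtains g where "under R i t = (\<lambda>x. ereal (g x))" "\<And>x. 0 \<le> g x"
    "convex_problem P \<and> norm_penalties P \<Longrightarrow> convex_on UNIV g"
proof -
  let ?nice = "\<lambda>i t. \<exists>g. under R i t = (\<lambda>x. ereal (g x)) \<and> (\<forall>x. 0 \<le> g x) \<and>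
    (convex_problem P \<and> norm_penalties P \<longrightarrow> convex_on UNIV g)"
  have zero: "?nice i t" if "under R i t = (\<lambda>x. 0)" for i t
    by (rule exI[of _ "\<lambda>x. 0"]) (simp add: that zero_ereal_def convex_on_const)
  have "?nice i t" using assms
  proof (induction i arbitrary: t)
    case 0
    then show ?case using init by (intro zero) (simp add: ddp_init_def)
  next
    case (Suc i)
    show ?case using Suc.prems(2)
    proof (induction rule: inc_induct)
      case base
      show ?case by (rule zero) (rule under_horizon)
    next
      case (step t)
      have i: "Suc i \<in> {1..N}" using Suc.prems by auto
      obtain g where g: "under R (Suc i) (Suc t) = (\<lambda>x. ereal (g x))" "\<And>x. 0 \<le> g x"
        using step.IH by blast
      have "i \<le> N" "t \<le> horizon P" using Suc.prems step.hyps by auto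
      then obtain h where h: "under R i t = (\<lambda>x. ereal (h x))" "\<And>x. 0 \<le> h x"
          "convex_problem P \<and> norm_penalties P \<Longrightarrow> convex_on UNIV h"
        using Suc.IH by blast
      have "\<forall>m\<in>nodes P (Suc t). \<exists>c. low_val P R (Suc i) (Suc t) m = ereal c"
        using low_val_real[OF i _ _ g] step.hyps by metis
      then obtain c where c: "\<And>m. m \<in> nodes P (Suc t) \<Longrightarrow> low_val P R (Suc i) (Suc t) m = ereal (c m)"
        by metis
      define s where "s = state R (Suc i) t"
      define l where "l m = fst (mult R (Suc i) m)" for m
      define \<rho> where "\<rho> m = snd (mult R (Suc i) m)" for m
      define C where "C x = (\<Sum>m\<in>nodes P (Suc t). trans P t m *
          (- (l m \<bullet> (s - x)) - \<rho> m * pen P m (s - x) + c m))" for x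
      have "under R (Suc i) t = (\<lambda>x. ereal (max (h x) (C x)))"
        using under_step[OF i] step.hyps h(1)
        by (auto simp: update_under_def fun_eq_iff cut_def c C_def l_def \<rho>_def s_def
            simp flip: max_def ereal_max intro!: arg_cong2[where f = max] sum.cong)
      moreover have "0 \<le> max (h x) (C x)" for x using h(2)[of x] by simp
      moreover have "convex_on UNIV (\<lambda>x. max (h x) (C x))" if conv: "convex_problem P \<and> norm_penalties P"
      proof -
        have \<rho>: "\<rho> m = 0" if m: "m \<in> nodes P (Suc t)" for m
          using mult_optimal(1)[OF i _ m] bounds_convex(2)[OF _ m conv] step.hyps
          by (auto simp: \<rho>_def dual_feas_def)
        have C: "C ((1 - a) *\<^sub>R x + a *\<^sub>R y) = (1 - a) * C x + a * C y" for a x y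
        proof -
          have "s - ((1 - a) *\<^sub>R x + a *\<^sub>R y) = (1 - a) *\<^sub>R (s - x) + a *\<^sub>R (s - y)"
            by (simp add: algebra_simps)
          then have "C ((1 - a) *\<^sub>R x + a *\<^sub>R y) = (\<Sum>m\<in>nodes P (Suc t).
              (1 - a) * (trans P t m * (- (l m \<bullet> (s - x)) + c m)) +
              a * (trans P t m * (- (l m \<bullet> (s - y)) + c m)))"
            unfolding C_def by (intro sum.cong refl) (simp add: \<rho> inner_add_right algebra_simps)
          also have "\<dots> = (1 - a) * C x + a * C y"
            unfolding C_def by (simp add: \<rho> sum.distrib sum_distrib_left cong: sum.cong)
          finally show ?thesis .
        qed
        show ?thesis
        proof (rule convex_onI)
          fix a :: real and x y :: 'a
          assume a: "0 < a" "a < 1"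
          have "h ((1 - a) *\<^sub>R x + a *\<^sub>R y) \<le> (1 - a) * h x + a * h y"
            using convex_onD[OF h(3)[OF conv], of a x y] a by simp
          also have "\<dots> \<le> (1 - a) * max (h x) (C x) + a * max (h y) (C y)"
            using a by (intro add_mono mult_left_mono) auto
          finally show "max (h ((1 - a) *\<^sub>R x + a *\<^sub>R y)) (C ((1 - a) *\<^sub>R x + a *\<^sub>R y))
              \<le> (1 - a) * max (h x) (C x) + a * max (h y) (C y)"
            using a unfolding C by (intro max.boundedI add_mono mult_left_mono) auto
        qed auto
      qed
      ultimately show ?case by (intro exI[of _ "\<lambda>x. max (h x) (C x)"]) blast
    qed
  qed
  then show ?thesis using that by blast
qed

lemma under_mono:
  assumes "i \<in> {1..N}" "t \<le> horizon P"
  shows "under R (i - 1) t x \<le> under R i t x"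
  using under_step[OF assms(1)] under_horizon assms(2)
  by (cases "t = horizon P") (auto simp: update_under_def)

lemma cuts_le_under:
  assumes "i \<in> {1..N}" "t < horizon P" "i \<le> j" "j \<le> N"
  shows "(\<Sum>m\<in>nodes P (Suc t). ereal (trans P t m) * cut P R i (Suc t) m x) \<le> under R j t x"
  using assms(3,4)
proof (induction rule: dec_induct)
  case base
  show ?case using under_step[OF assms(1,2)] by (simp add: update_under_def)
next
  case (step j)
  then show ?case using under_mono[of "Suc j" t x] assms(2) by auto
qed

text \<open>In the convex case this rests on \<open>biconjugate_on_le\<close>, hence the restriction
  to points of the stage's subspace.\<close>

lemma over_le:
  assumes "i \<in> {1..N}" "t < horizon P" "x \<in> sspace P t"
  shows "over R i t x \<le> over R (i - 1) t x" "over R i t x \<le> over_piece P R i t x"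
proof -
  have "over R i t x \<le> min (over R (i - 1) t x) (over_piece P R i t x)"
    using over_step[OF assms(1,2)]
      biconjugate_on_le[OF assms(3), of "\<lambda>x. min (over R (i - 1) t x) (over_piece P R i t x)"]
    by (simp add: update_over_def Let_def)
  then show "over R i t x \<le> over R (i - 1) t x" "over R i t x \<le> over_piece P R i t x"
    by auto
qed

lemma over_le_piece:
  assumes "i \<in> {1..N}" "t < horizon P" "i \<le> j" "j \<le> N" "x \<in> sspace P t"
  shows "over R j t x \<le> over_piece P R i t x"
  using assms(3,4)
proof (induction rule: dec_induct)
  case base
  show ?case using over_le[OF assms(1,2,5)] by simp
next
  case (step j)
  then show ?case using over_le(1)[of "Suc j" t x] assms(2,5) by auto
qed

section \<open>Absence of a duality gap at a node\<close>

text \<open>Strong duality with a linear multiplier alone: minimizing a jointly convex cost over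
  \<open>(x, y)\<close> leaves a convex problem in \<open>z\<close>, to which
  \<open>norm_penalty_multiplier\<close> applies.\<close>

lemma norm_penalty_dual_feas:
  assumes conv: "convex_problem P \<and> norm_penalties P"
    and t: "t < horizon P" and m: "m \<in> nodes P (Suc t)" and u: "u \<in> states P t"
    and g: "convex_on UNIV g" "\<And>x. 0 \<le> g x"
    and b: "\<And>w. w \<in> node_feas P (Suc t) m \<Longrightarrow>
      ereal b \<le> node_cost P m (\<lambda>x. ereal (g x)) u w"
  obtains l where "(l, 0) \<in> dual_feas P (Suc t) m"
    "ereal b \<le> dual_inner P (Suc t) m (\<lambda>x. ereal (g x)) u (l, 0)"
proof -
  \<comment> \<open>The projection to \<open>(z, r)\<close> of the epigraph of stage cost plus
    cost-to-go; a real \<open>r\<close> admits only decisions of finite cost.\<close>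
  define S where "S = {(z, r). \<exists>x y. ((x, y), z) \<in> node_feas P (Suc t) m \<and>
    stagecost P m z y x + ereal (g x) \<le> ereal r}"
  have prev: "prev_states P (Suc t) = states P t" by (simp add: prev_states_def)
  have cc: "econvex_on (states P t \<times> feas P m) (\<lambda>(z, x, y). stagecost P m z y x)"
    using conv m t unfolding convex_problem_def prev[symmetric] by (meson Suc_leI)
  have pen: "pen P m v = snorm P t v" if "v \<in> sspace P t" for v
    using conv m t that unfolding norm_penalties_def
    by (auto dest!: bspec[of _ _ "Suc t"])
  have nonneg: "0 \<le> stagecost P m z y x" if "((x, y), z) \<in> node_feas P (Suc t) m" for x y z
    using that stagecost_nonneg[OF _ m] t by (auto simp: node_feas_def)
  have "convex S"
  proof (rule convexI)
    fix w w' :: "'a \<times> real" and p q :: real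
    assume S: "w \<in> S" "w' \<in> S" and pq: "0 \<le> p" "0 \<le> q" "p + q = 1"
    obtain z r z' r' where w: "w = (z, r)" "w' = (z', r')" by fastforce
    obtain x y x' y' where f: "((x, y), z) \<in> node_feas P (Suc t) m" "((x', y'), z') \<in> node_feas P (Suc t) m"
      and c: "stagecost P m z y x + ereal (g x) \<le> ereal r" "stagecost P m z' y' x' + ereal (g x') \<le> ereal r'"
      using S by (auto simp: S_def w)
    obtain a a' where a: "stagecost P m z y x = ereal a" "stagecost P m z' y' x' = ereal a'"
      using c nonneg[OF f(1)] nonneg[OF f(2)]
      by (cases "stagecost P m z y x"; cases "stagecost P m z' y' x'") auto
    have p: "p = 1 - q" using pq by simp
    define v where "v = (1 - q) *\<^sub>R (z, x, y) + q *\<^sub>R (z', x', y')"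
    have mem: "(z, x, y) \<in> states P t \<times> feas P m" "(z', x', y') \<in> states P t \<times> feas P m"
      using f by (auto simp: node_feas_def prev)
    have "v \<in> states P t \<times> feas P m"
      unfolding v_def using cc mem pq by (intro convexD) (auto simp: econvex_on_def)
    moreover have "(case v of (z, x, y) \<Rightarrow> stagecost P m z y x) \<le> ereal (1 - q) * ereal a + ereal q * ereal a'"
      using cc mem pq a unfolding econvex_on_def v_def by force
    moreover have "v = (p *\<^sub>R z + q *\<^sub>R z', p *\<^sub>R x + q *\<^sub>R x', p *\<^sub>R y + q *\<^sub>R y')"
      by (simp add: v_def p)
    ultimately have v: "((p *\<^sub>R x + q *\<^sub>R x', p *\<^sub>R y + q *\<^sub>R y'), p *\<^sub>R z + q *\<^sub>R z') \<in> node_feas P (Suc t) m"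
      "stagecost P m (p *\<^sub>R z + q *\<^sub>R z') (p *\<^sub>R y + q *\<^sub>R y') (p *\<^sub>R x + q *\<^sub>R x') \<le> ereal (p * a + q * a')"
      by (auto simp: node_feas_def prev p)
    have "g (p *\<^sub>R x + q *\<^sub>R x') \<le> p * g x + q * g x'"
      using convex_onD[OF g(1), of q x x'] pq by (simp add: p)
    then have "p * a + q * a' + g (p *\<^sub>R x + q *\<^sub>R x') \<le> p * (a + g x) + q * (a' + g x')"
      by (simp add: algebra_simps)
    also have "\<dots> \<le> p * r + q * r'"
      using c a pq by (intro add_mono mult_left_mono) auto
    finally have "ereal (p * a + q * a') + ereal (g (p *\<^sub>R x + q *\<^sub>R x')) \<le> ereal (p * r + q * r')"
      by simp
    with v(2) have "stagecost P m (p *\<^sub>R z + q *\<^sub>R z') (p *\<^sub>R y + q *\<^sub>R y') (p *\<^sub>R x + q *\<^sub>R x')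
        + ereal (g (p *\<^sub>R x + q *\<^sub>R x')) \<le> ereal (p * r + q * r')"
      by (meson add_right_mono order_trans)
    with v(1) show "p *\<^sub>R w + q *\<^sub>R w' \<in> S" by (auto simp: S_def w)
  qed
  moreover have "S \<noteq> {}"
  proof -
    obtain x y z where "z \<in> prev_states P (Suc t)" "(x, y) \<in> feas P m" "stagecost P m z y x < \<infinity>"
      using finite_stagecost[OF _ m] t by (metis Suc_leI)
    moreover from this obtain a where "stagecost P m z y x = ereal a"
      using nonneg[of x y z] by (cases "stagecost P m z y x") (auto simp: node_feas_def)
    ultimately have "(z, a + g x) \<in> S"
      by (auto simp: S_def node_feas_def intro!: exI[of _ x] exI[of _ y])
    then show ?thesis by blast
  qed
  moreover have SE: "z \<in> sspace P t" if "(z, r) \<in> S" for z r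
    using that states_sspace[OF t] by (auto simp: S_def node_feas_def prev)
  moreover have "b \<le> r + pcoef P m * snorm P t (u - z)" if zr: "(z, r) \<in> S" for z r
  proof -
    obtain x y where f: "((x, y), z) \<in> node_feas P (Suc t) m"
      and c: "stagecost P m z y x + ereal (g x) \<le> ereal r"
      using zr by (auto simp: S_def)
    have "pen P m (u - z) = snorm P t (u - z)"
      using SE[OF zr] states_sspace[OF t u] subspace_sspace[OF t] by (intro pen subspace_diff)
    moreover have "ereal b \<le> node_cost P m (\<lambda>x. ereal (g x)) u ((x, y), z)" by (rule b[OF f])
    ultimately show ?thesis
      using c nonneg[OF f] by (cases "stagecost P m z y x") (auto simp: node_cost_def)
  qed
  moreover have "0 \<le> pcoef P m" using pcoef_pos[of "Suc t" m] m t by simp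
  ultimately obtain l where l: "l \<in> sspace P t" "dual_norm_on (sspace P t) (snorm P t) l \<le> pcoef P m"
      "\<And>z r. (z, r) \<in> S \<Longrightarrow> b \<le> r + l \<bullet> (u - z)"
    using norm_penalty_multiplier[OF subspace_sspace[OF t] norm_on_snorm[OF t] states_sspace[OF t u],
        of "pcoef P m" S b] by metis
  show ?thesis
  proof
    show "(l, 0) \<in> dual_feas P (Suc t) m"
      using l(1,2) bounds_convex[OF t m conv] by (simp add: dual_feas_def prev_space_def)
    have "ereal b \<le> stagecost P m z y x + ereal (l \<bullet> (u - z)) + ereal (g x)"
      if f: "((x, y), z) \<in> node_feas P (Suc t) m" for x y z
    proof (cases "stagecost P m z y x")
      case (real a)
      then have "(z, a + g x) \<in> S" using f by (auto simp: S_def intro!: exI[of _ x] exI[of _ y])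
      then show ?thesis using l(3)[of z "a + g x"] by (simp add: real algebra_simps)
    qed (use nonneg[OF f] in auto)
    then show "ereal b \<le> dual_inner P (Suc t) m (\<lambda>x. ereal (g x)) u (l, 0)"
      by (auto simp: dual_inner_def intro!: INF_greatest)
  qed
qed

lemma dual_inner_mono:
  assumes "\<And>x. V x \<le> V' x"
  shows "dual_inner P t m V u w \<le> dual_inner P t m V' u w"
  unfolding dual_inner_def using assms
  by (auto intro!: INF_mono' add_left_mono simp: split_beta)

text \<open>Both values are compared with the optimal value \<open>b\<close> of the forward problem.
  The dual value is at least \<open>b\<close> by duality. The upper value, taken at the forward
  solution, exceeds \<open>b\<close> by at most the gap at the state of that solution.\<close>

lemma node_gap:
  assumes i: "i \<in> {1..N}" and t: "t < horizon P" and m: "m \<in> nodes P (Suc t)" and G: "0 \<le> G"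
    and gap: "Suc t < horizon P \<Longrightarrow> gap R i (Suc t) m \<le> ereal G"
  obtains b where "ereal b \<le> low_val P R i (Suc t) m" "up_val P R i (Suc t) m \<le> ereal (b + G)"
proof -
  define u where "u = state R i t"
  have u: "u \<in> states P t" unfolding u_def using i t by (rule state_in_states)
  obtain x y z where sol: "sol R i m = ((x, y), z)" by (metis prod.exhaust)
  have f: "((x, y), z) \<in> node_feas P (Suc t) m" using sol_optimal(1)[OF i t m] by (simp add: sol)
  have "i - 1 \<le> N" "Suc t \<le> horizon P" using i t by auto
  then obtain g where g: "under R (i - 1) (Suc t) = (\<lambda>x. ereal (g x))" "\<And>x. 0 \<le> g x"
      "convex_problem P \<and> norm_penalties P \<Longrightarrow> convex_on UNIV g"
    using under_real by blast
  have opt: "node_cost P m (\<lambda>x. ereal (g x)) u ((x, y), z) \<le> node_cost P m (\<lambda>x. ereal (g x)) u w"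
    if "w \<in> node_feas P (Suc t) m" for w
    using sol_optimal(2)[OF i t m that] unfolding g(1) u_def sol .
  obtain x' y' z' where xyz: "z' \<in> prev_states P (Suc t)" "(x', y') \<in> feas P m"
      "stagecost P m z' y' x' < \<infinity>"
    using finite_stagecost[OF _ m] t by (metis Suc_leI)
  have "node_cost P m (\<lambda>x. ereal (g x)) u ((x, y), z) \<le> node_cost P m (\<lambda>x. ereal (g x)) u ((x', y'), z')"
    using xyz by (intro opt) (simp add: node_feas_def)
  also have "\<dots> < \<infinity>" using xyz(3) by (simp add: node_cost_def)
  finally have "stagecost P m z y x < \<infinity>" by (auto simp: node_cost_def)
  moreover have "0 \<le> stagecost P m z y x"
    using f stagecost_nonneg[OF _ m] t by (auto simp: node_feas_def)
  ultimately obtain a where a: "stagecost P m z y x = ereal a"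
    by (cases "stagecost P m z y x") auto
  define b where "b = a + pcoef P m * pen P m (u - z) + g x"
  have b: "ereal b \<le> node_cost P m (\<lambda>x. ereal (g x)) u w" if "w \<in> node_feas P (Suc t) m" for w
    using opt[OF that] by (simp add: node_cost_def b_def a)
  have "\<exists>w\<in>dual_feas P (Suc t) m. ereal b \<le> dual_inner P (Suc t) m (\<lambda>x. ereal (g x)) u w"
  proof (cases "convex_problem P \<and> norm_penalties P")
    case True
    then show ?thesis using norm_penalty_dual_feas[OF True t m u g(3)[OF True] g(2) b] by metis
  next
    case False
    \<comment> \<open>With this multiplier the inner dual problem is the forward problem
      itself.\<close>
    then have "(0, pcoef P m) \<in> dual_feas P (Suc t) m"
      using bounds_nonconvex[OF t m] pcoef_pos[of "Suc t" m] m t by (intro dual_zero_feas) auto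
    moreover have "ereal b \<le> dual_inner P (Suc t) m (\<lambda>x. ereal (g x)) u (0, pcoef P m)"
      using b by (fastforce simp: dual_inner_def node_cost_def intro!: INF_greatest)
    ultimately show ?thesis by blast
  qed
  then obtain w where w: "w \<in> dual_feas P (Suc t) m"
      "ereal b \<le> dual_inner P (Suc t) m (\<lambda>x. ereal (g x)) u w"
    by blast
  note w(2)
  \<comment> \<open>The backward step uses the updated lower approximation, which can only raise the
    inner minimum.\<close>
  also have "dual_inner P (Suc t) m (\<lambda>x. ereal (g x)) u w \<le> dual_inner P (Suc t) m (under R i (Suc t)) u w"
    using under_mono[OF i, of "Suc t"] t unfolding g(1) by (intro dual_inner_mono) simp
  also have "\<dots> \<le> low_val P R i (Suc t) m"
    unfolding low_val_def dual_value_def using w(1) by (intro SUP_upper2) (auto simp: u_def)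
  finally have low: "ereal b \<le> low_val P R i (Suc t) m" .
  \<comment> \<open>At the horizon the upper approximation is zero, so nonnegativity suffices.
    Before it, the gap bound for the old approximations carries over since the upper one only
    decreases.\<close>
  have over: "over R i (Suc t) x \<le> ereal (g x + G)"
  proof (cases "Suc t = horizon P")
    case True
    then show ?thesis using over_horizon g(2)[of x] G by simp
  next
    case False
    then have t': "Suc t < horizon P" using t by simp
    have "x \<in> states P (Suc t)" using f fst_feas[OF t' m] by (force simp: node_feas_def)
    then have "over R i (Suc t) x \<le> over R (i - 1) (Suc t) x"
      by (intro over_le[OF i t'] states_sspace[OF t'])
    also have "\<dots> \<le> ereal (g x + G)"
      using gap[OF t'] unfolding gap_def sol_x_def sol g(1)
      by (cases "over R (i - 1) (Suc t) x") auto
    finally show ?thesis .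
  qed
  have "up_val P R i (Suc t) m = ereal (a + pcoef P m * pen P m (u - z)) + over R i (Suc t) x"
    by (simp add: up_val_def node_cost_def sol a u_def)
  also have "\<dots> \<le> ereal (a + pcoef P m * pen P m (u - z)) + ereal (g x + G)"
    by (rule add_left_mono[OF over])
  also have "\<dots> = ereal (b + G)" by (simp add: b_def)
  finally show ?thesis by (rule that[OF low])
qed

section \<open>Gaps near visited states and at the root\<close>

text \<open>By \<open>node_gap\<close> the upper piece and the cut of iteration \<open>i\<close>
  differ by at most \<open>G\<close> at the visited state, and their slopes control the growth away
  from it. Later updates only tighten the approximations.\<close>

lemma gap_near_state:
  assumes i: "i \<in> {1..N}" and t: "t < horizon P" and G: "0 \<le> G"
    and gap: "\<And>m. Suc t < horizon P \<Longrightarrow> m \<in> nodes P (Suc t) \<Longrightarrow> gap R i (Suc t) m \<le> ereal G"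
    and x: "x \<in> states P t" and j: "i \<le> j" "j \<le> N"
  shows "over R j t x - under R j t x
    \<le> ereal (G + 2 * lip_const P t * snorm P t (x - state R i t))"
proof -
  define s where "s = state R i t"
  define d where "d = snorm P t (x - s)"
  have s: "s \<in> states P t" unfolding s_def using i t by (rule state_in_states)
  have E: "subspace (sspace P t)" "norm_on (sspace P t) (snorm P t)" "s \<in> sspace P t" "x \<in> sspace P t"
    using subspace_sspace[OF t] norm_on_snorm[OF t] states_sspace[OF t] s x by auto
  have d: "0 \<le> d" "snorm P t (s - x) = d"
    using norm_on_nonneg[OF E(2)] norm_on_minus_commute[OF E(2,1)] E by (auto simp: d_def subspace_diff)
  have "\<exists>b. ereal b \<le> low_val P R i (Suc t) m \<and> up_val P R i (Suc t) m \<le> ereal (b + G)"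
    if "m \<in> nodes P (Suc t)" for m
    using node_gap[OF i t that G gap] that by metis
  then obtain b where b: "\<And>m. m \<in> nodes P (Suc t) \<Longrightarrow> ereal (b m) \<le> low_val P R i (Suc t) m"
      "\<And>m. m \<in> nodes P (Suc t) \<Longrightarrow> up_val P R i (Suc t) m \<le> ereal (b m + G)"
    by metis
  have "over R j t x \<le> over_piece P R i t x"
    by (rule over_le_piece[OF i t j E(4)])
  also have "\<dots> \<le> (\<Sum>m\<in>nodes P (Suc t). ereal (trans P t m) * ereal (b m + G + pcoef P m * d))"
    unfolding over_piece_def
  proof (intro sum_mono ereal_mult_left_mono)
    fix m assume m: "m \<in> nodes P (Suc t)"
    show "up_val P R i (Suc t) m + ereal (pcoef P m * snorm P t (x - state R i t))
        \<le> ereal (b m + G + pcoef P m * d)"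
      using add_right_mono[OF b(2)[OF m], of "ereal (pcoef P m * d)"] by (simp add: d_def s_def)
    show "0 \<le> ereal (trans P t m)" using trans_pos[OF t m] by simp
  qed
  also have "\<dots> = ereal (\<Sum>m\<in>nodes P (Suc t). trans P t m * (b m + G + pcoef P m * d))" by simp
  finally have up: "over R j t x \<le> \<dots>" .
  have "ereal (\<Sum>m\<in>nodes P (Suc t). trans P t m * (b m - (lbnd P m + rbnd P m) * d))
      = (\<Sum>m\<in>nodes P (Suc t). ereal (trans P t m) * ereal (b m - (lbnd P m + rbnd P m) * d))" by simp
  also have "\<dots> \<le> (\<Sum>m\<in>nodes P (Suc t). ereal (trans P t m) * cut P R i (Suc t) m x)"
  proof (intro sum_mono ereal_mult_left_mono)
    fix m assume m: "m \<in> nodes P (Suc t)"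
    obtain l \<rho> where l: "mult R i m = (l, \<rho>)" by fastforce
    have lf: "dual_norm_on (sspace P t) (snorm P t) l \<le> lbnd P m" "0 \<le> \<rho>" "\<rho> \<le> rbnd P m"
      using mult_optimal(1)[OF i t m] by (auto simp: l dual_feas_def prev_space_def)
    \<comment> \<open>The dual norm bounds the linear part of the cut and the Lipschitz property its
      penalty part, so it drops at slope at most \<open>lbnd P m + rbnd P m\<close>.\<close>
    have "l \<bullet> (s - x) \<le> dual_norm_on (sspace P t) (snorm P t) l * d"
      unfolding d(2)[symmetric] using E by (intro inner_le_dual_norm_on subspace_diff)
    also have "\<dots> \<le> lbnd P m * d" using lf d by (intro mult_right_mono) auto
    finally have "l \<bullet> (s - x) \<le> lbnd P m * d" .
    moreover have "\<rho> * pen P m (s - x) \<le> rbnd P m * d"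
      using lf pen_le_snorm[OF t m s x] pen_nonneg[OF t m, of "s - x"] E d
      by (intro mult_mono) (auto simp: subspace_diff)
    ultimately have "b m - (lbnd P m + rbnd P m) * d \<le> - (l \<bullet> (s - x)) - \<rho> * pen P m (s - x) + b m"
      by (simp add: algebra_simps)
    then have "ereal (b m - (lbnd P m + rbnd P m) * d)
        \<le> ereal (- (l \<bullet> (s - x)) - \<rho> * pen P m (s - x)) + ereal (b m)" by simp
    also have "\<dots> \<le> cut P R i (Suc t) m x"
      unfolding cut_def by (intro add_mono b(1)[OF m]) (simp add: l s_def)
    finally show "ereal (b m - (lbnd P m + rbnd P m) * d) \<le> cut P R i (Suc t) m x" .
    show "0 \<le> ereal (trans P t m)" using trans_pos[OF t m] by simp
  qed
  also have "\<dots> \<le> under R j t x" by (rule cuts_le_under[OF i t j])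
  finally have low: "ereal (\<Sum>m\<in>nodes P (Suc t). trans P t m * (b m - (lbnd P m + rbnd P m) * d))
      \<le> under R j t x" .
  have "over R j t x - under R j t x
      \<le> ereal (\<Sum>m\<in>nodes P (Suc t). trans P t m * (b m + G + pcoef P m * d))
        - ereal (\<Sum>m\<in>nodes P (Suc t). trans P t m * (b m - (lbnd P m + rbnd P m) * d))"
    by (rule ereal_minus_mono[OF up low])
  also have "\<dots> = ereal (\<Sum>m\<in>nodes P (Suc t). trans P t m * G
      + trans P t m * (pcoef P m + (lbnd P m + rbnd P m)) * d)"
    by (simp add: sum_subtractf[symmetric] algebra_simps)
  \<comment> \<open>The slope \<open>pcoef P m\<close> of the upper piece is at most that of the
    cut; hence the factor 2.\<close>
  also have "\<dots> \<le> ereal (\<Sum>m\<in>nodes P (Suc t). trans P t m * G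
      + 2 * (trans P t m * (lbnd P m + rbnd P m)) * d)"
  proof -
    have "trans P t m * (pcoef P m + (lbnd P m + rbnd P m)) * d
        \<le> 2 * (trans P t m * (lbnd P m + rbnd P m)) * d" if "m \<in> nodes P (Suc t)" for m
    proof -
      have "trans P t m * (pcoef P m + (lbnd P m + rbnd P m))
          \<le> trans P t m * (2 * (lbnd P m + rbnd P m))"
        using trans_pos[OF t that] pcoef_le_bounds[OF t that] by (intro mult_left_mono) auto
      from mult_right_mono[OF this d(1)] show ?thesis by (simp only: mult.left_commute)
    qed
    then show ?thesis by (simp only: ereal_less_eq) (intro sum_mono add_left_mono)
  qed
  also have "(\<Sum>m\<in>nodes P (Suc t). trans P t m * G + 2 * (trans P t m * (lbnd P m + rbnd P m)) * d)
      = G + 2 * lip_const P t * d"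
    using sum_trans[OF t]
    by (simp add: sum.distrib lip_const_def flip: sum_distrib_left sum_distrib_right)
  finally show ?thesis by (simp add: d_def s_def)
qed

text \<open>The current root decision attains \<open>LB\<close>, and \<open>UB\<close> is at most
  its upper value. Subtraction cancels the stage cost, and the loop condition gives the
  claim.\<close>

lemma root_gap:
  assumes i: "i \<in> {1..N}"
  shows "ereal \<epsilon> < over R (i - 1) 0 (state R i 0) - under R (i - 1) 0 (state R i 0)"
proof -
  define w where "w = (state R i 0, root_y R i)"
  have h: "0 < horizon P" using horizon_pos by simp
  have gap: "ereal \<epsilon> < UB R (i - 1) - LB R (i - 1)"
    using run i by (simp add: ddp_terminates_in_def)
  obtain g where g: "under R (i - 1) 0 = (\<lambda>x. ereal (g x))" "\<And>x. 0 \<le> g x"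
    using under_real[OF _ le0, of "i - 1"] i by (metis atLeastAtMost_iff diff_le_self le_trans)
  \<comment> \<open>The last alternative covers \<open>i = 1\<close>, where the upper approximation
    is still identically infinite.\<close>
  have "LB R (i - 1) = root_cost P (under R (i - 1) 0) w \<and>
      is_arg_min (root_cost P (under R (i - 1) 0)) (\<lambda>w. w \<in> feas P (root P)) w \<and>
      (UB R (i - 1) \<le> root_cost P (over R (i - 1) 0) w \<or> over R (i - 1) 0 = (\<lambda>x. \<infinity>))"
  proof (cases "i = 1")
    case True
    have "root_cost P (\<lambda>x. 0) = (\<lambda>(x, y). stagecost P (root P) 0 y x)"
      by (auto simp: root_cost_def)
    then show ?thesis using init h True by (simp add: ddp_init_def w_def)
  next
    case False
    then have "i - 1 \<in> {1..N}" "i - 1 + 1 = i" using i by auto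
    then show ?thesis
      using root[of "i - 1"] by (auto simp: ddp_root_def w_def Let_def split: if_splits)
  qed
  then have LB: "LB R (i - 1) = root_cost P (under R (i - 1) 0) w"
    and opt: "is_arg_min (root_cost P (under R (i - 1) 0)) (\<lambda>w. w \<in> feas P (root P)) w"
    and UB: "UB R (i - 1) \<le> root_cost P (over R (i - 1) 0) w \<or> over R (i - 1) 0 = (\<lambda>x. \<infinity>)"
    by blast+
  \<comment> \<open>The root stage cost must be finite to cancel in extended arithmetic.\<close>
  obtain x y z where "z \<in> prev_states P 0" "(x, y) \<in> feas P (root P)"
      "stagecost P (root P) z y x < \<infinity>"
    using finite_stagecost[of 0 "root P"] nodes_0 by (metis le0 singletonI)
  then have "root_cost P (under R (i - 1) 0) w < \<infinity>"
    using opt unfolding is_arg_min_linorder g(1)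
    by (auto simp: prev_states_def root_cost_def dest!: spec[of _ "(x, y)"])
  moreover have "0 \<le> stagecost P (root P) 0 (root_y R i) (state R i 0)"
    using stagecost_nonneg[of 0 "root P" 0] nodes_0 root_in_feas[OF i] by (simp add: prev_states_def)
  ultimately obtain a where a: "stagecost P (root P) 0 (root_y R i) (state R i 0) = ereal a"
    by (cases "stagecost P (root P) 0 (root_y R i) (state R i 0)") (auto simp: root_cost_def w_def)
  show ?thesis
  proof (cases "over R (i - 1) 0 (state R i 0) = \<infinity>")
    case True
    then show ?thesis by (simp add: g(1))
  next
    case False
    then have "UB R (i - 1) \<le> root_cost P (over R (i - 1) 0) w" using UB by auto
    then have "UB R (i - 1) - LB R (i - 1)
        \<le> root_cost P (over R (i - 1) 0) w - root_cost P (under R (i - 1) 0) w"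
      unfolding LB by (intro ereal_minus_mono) auto
    also have "\<dots> = over R (i - 1) 0 (state R i 0) - under R (i - 1) 0 (state R i 0)"
      unfolding g(1)
      by (cases "over R (i - 1) 0 (state R i 0)") (auto simp: root_cost_def w_def a)
    finally show ?thesis using gap by simp
  qed
qed

text \<open>The sampling rule enters here: the visited state belongs to a node of largest gap, so
  one gap controls the whole stage.\<close>

lemma gap_le_state_gap:
  assumes "i \<in> {1..N}" "0 < t" "t < horizon P" "m \<in> nodes P t"
  shows "gap R i t m \<le> over R (i - 1) t (state R i t) - under R (i - 1) t (state R i t)"
proof -
  obtain n' where "is_arg_max (gap R i t) (\<lambda>n. n \<in> nodes P t) n'" "state R i t = sol_x R i n'"
    using bspec[OF forward[OF assms(1), unfolded ddp_forward_def], of t] assms(2,3) by auto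
  then show ?thesis using assms(4) by (auto simp: is_arg_max_linorder gap_def)
qed

section \<open>Counting the iterations\<close>

lemma iteration_bound:
  fixes \<delta> :: "nat \<Rightarrow> real" and B :: "nat \<Rightarrow> nat \<Rightarrow> 'a set" and D :: "nat \<Rightarrow> nat \<Rightarrow> real"
  assumes \<delta>: "\<And>t. t < horizon P \<Longrightarrow> 0 < \<delta> t" "(\<Sum>t<horizon P. \<delta> t) = \<epsilon>"
    and B: "\<And>t k. t < horizon P \<Longrightarrow> k \<in> {1..K t} \<Longrightarrow>
           norm_ball (sspace P t) (snorm P t) (B t k) \<and>
           0 \<le> D t k \<and> norm_diameter (snorm P t) (B t k) = ereal (D t k)"
    and cover: "\<And>t. t < horizon P \<Longrightarrow> states P t \<subseteq> (\<Union>k\<in>{1..K t}. B t k)"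
  shows "real N \<le> (\<Sum>t<horizon P. \<Sum>k=1..K t.
           (1 + 2 * lip_const P t * D t k / \<delta> t) ^ dim (sspace P t))"
proof -
  \<comment> \<open>The tolerance reserved for stages from \<open>t\<close> on; in particular
    \<open>\<Delta> 0 = \<epsilon>\<close>.\<close>
  define \<Delta> where "\<Delta> t = (\<Sum>s=t..<horizon P. \<delta> s)" for t
  \<comment> \<open>Index \<open>i - 1\<close> because the forward step of iteration
    \<open>i\<close> sees the approximations before their update.\<close>
  define \<gamma> where "\<gamma> i t = over R (i - 1) t (state R i t) - under R (i - 1) t (state R i t)" for i t
  define A where "A i = {t. t < horizon P \<and> ereal (\<Delta> t) < \<gamma> i t}" for i
  define \<tau> where "\<tau> i = Max (A i)" for i
  have \<Delta>_nonneg: "0 \<le> \<Delta> t" for t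
    unfolding \<Delta>_def using \<delta>(1) by (intro sum_nonneg) (auto intro: less_imp_le)
  have \<Delta>_Suc: "\<Delta> t = \<delta> t + \<Delta> (Suc t)" if "t < horizon P" for t
    unfolding \<Delta>_def using that by (rule sum.atLeast_Suc_lessThan)
  have \<tau>: "\<tau> i < horizon P" "ereal (\<Delta> (\<tau> i)) < \<gamma> i (\<tau> i)"
    "\<And>t. t < horizon P \<Longrightarrow> \<tau> i < t \<Longrightarrow> \<gamma> i t \<le> ereal (\<Delta> t)" if i: "i \<in> {1..N}" for i
  proof -
    have fin: "finite (A i)" by (rule finite_subset[of _ "{..<horizon P}"]) (auto simp: A_def)
    have "0 \<in> A i"
      using root_gap[OF i] horizon_pos \<delta>(2) by (simp add: A_def \<gamma>_def \<Delta>_def atLeast0LessThan)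
    then have "\<tau> i \<in> A i" unfolding \<tau>_def using fin by (intro Max_in) auto
    then show "\<tau> i < horizon P" "ereal (\<Delta> (\<tau> i)) < \<gamma> i (\<tau> i)" by (auto simp: A_def)
    show "\<gamma> i t \<le> ereal (\<Delta> t)" if "t < horizon P" "\<tau> i < t" for t
    proof (rule ccontr)
      assume "\<not> \<gamma> i t \<le> ereal (\<Delta> t)"
      then have "t \<in> A i" using that(1) by (simp add: A_def)
      then show False using Max_ge[OF fin, of t] that(2) by (simp add: \<tau>_def)
    qed
  qed
  have separated: "\<delta> t / (2 * lip_const P t) \<le> snorm P t (state R j t - state R i t)"
    if i: "i \<in> {1..N}" and j: "j \<in> {1..N}" and ij: "i < j" and t: "\<tau> i = t" "\<tau> j = t" for i j t
  proof -
    have t': "t < horizon P" using \<tau>(1)[OF i] t by simp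
    have "ereal (\<Delta> t) < \<gamma> j t" using \<tau>(2)[OF j] t by simp
    also have "\<gamma> j t \<le> ereal (\<Delta> (Suc t) + 2 * lip_const P t * snorm P t (state R j t - state R i t))"
      unfolding \<gamma>_def
    proof (rule gap_near_state[OF i t' \<Delta>_nonneg])
      show "state R j t \<in> states P t" using j t' by (rule state_in_states)
      \<comment> \<open>Iteration \<open>j\<close> meets the approximations of \<open>j - 1\<close>,
        which already contain the update made in iteration \<open>i\<close>.\<close>
      show "i \<le> j - 1" "j - 1 \<le> N" using ij j by auto
      \<comment> \<open>Stage \<open>t + 1\<close> lies beyond the last stage with a large gap in
        iteration \<open>i\<close>.\<close>
      show "gap R i (Suc t) m \<le> ereal (\<Delta> (Suc t))" if "Suc t < horizon P" "m \<in> nodes P (Suc t)" for m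
        using gap_le_state_gap[OF i _ that] \<tau>(3)[OF i that(1)] t by (simp add: \<gamma>_def)
    qed
    finally have "\<delta> t < 2 * lip_const P t * snorm P t (state R j t - state R i t)"
      using \<Delta>_Suc[OF t'] by simp
    then show ?thesis using lip_const_pos[OF t'] by (simp add: field_simps)
  qed
  define I where "I t k = {i \<in> {1..N}. \<tau> i = t \<and> state R i t \<in> B t k}" for t k
  have card_I: "real (card (I t k)) \<le> (1 + 2 * lip_const P t * D t k / \<delta> t) ^ dim (sspace P t)"
    if t: "t < horizon P" and k: "k \<in> {1..K t}" for t k
  proof -
    let ?\<eta> = "\<delta> t / (2 * lip_const P t)"
    have \<eta>: "0 < ?\<eta>" using \<delta>(1)[OF t] lip_const_pos[OF t] by simp
    have sep: "?\<eta> \<le> snorm P t (state R i t - state R j t)" if "i \<in> I t k" "j \<in> I t k" "i \<noteq> j" for i j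
    proof -
      have ij: "i \<in> {1..N}" "j \<in> {1..N}" "\<tau> i = t" "\<tau> j = t" using that by (auto simp: I_def)
      have "snorm P t (state R i t - state R j t) = snorm P t (state R j t - state R i t)"
        using ij t by (intro norm_on_minus_commute[OF norm_on_snorm subspace_sspace]
            states_sspace state_in_states)
      then show ?thesis
        using separated[of i j t] separated[of j i t] ij \<open>i \<noteq> j\<close> by (cases "i < j") auto
    qed
    have "snorm P t 0 = 0"
      using norm_on_eq_0_iff[OF norm_on_snorm[OF t]] subspace_0[OF subspace_sspace[OF t]] by simp
    \<comment> \<open>Positive separation makes the visited states distinct, so counting iterations
      is counting points in the ball.\<close>
    then have "inj_on (\<lambda>i. state R i t) (I t k)"
      using sep \<eta> by (intro inj_onI) (force simp: not_less[symmetric])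
    then have "card (I t k) = card ((\<lambda>i. state R i t) ` I t k)" by (simp add: card_image)
    also have "real \<dots> \<le> (1 + D t k / ?\<eta>) ^ dim (sspace P t)"
      using B[OF t k] sep
      by (intro packing_bound_norm_ball[OF subspace_sspace[OF t] norm_on_snorm[OF t], of "B t k"] \<eta>)
        (auto simp: I_def)
    also have "D t k / ?\<eta> = 2 * lip_const P t * D t k / \<delta> t" by simp
    finally show ?thesis .
  qed
  have "{1..N} \<subseteq> (\<Union>t<horizon P. \<Union>k\<in>{1..K t}. I t k)"
  proof
    fix i assume i: "i \<in> {1..N}"
    have "state R i (\<tau> i) \<in> (\<Union>k\<in>{1..K (\<tau> i)}. B (\<tau> i) k)"
      using state_in_states[OF i \<tau>(1)[OF i]] cover[OF \<tau>(1)[OF i]] by blast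
    then show "i \<in> (\<Union>t<horizon P. \<Union>k\<in>{1..K t}. I t k)"
      using i \<tau>(1)[OF i] by (auto simp: I_def)
  qed
  moreover have finite_I: "finite (I t k)" for t k by (simp add: I_def)
  ultimately have "card {1..N} \<le> card (\<Union>t<horizon P. \<Union>k\<in>{1..K t}. I t k)"
    by (intro card_mono) auto
  also have "\<dots> \<le> (\<Sum>t<horizon P. card (\<Union>k\<in>{1..K t}. I t k))" by (intro card_UN_le) auto
  also have "\<dots> \<le> (\<Sum>t<horizon P. \<Sum>k=1..K t. card (I t k))" by (intro sum_mono card_UN_le) auto
  finally have "real N \<le> (\<Sum>t<horizon P. \<Sum>k=1..K t. real (card (I t k)))"
    by (simp flip: of_nat_sum)
  also have "\<dots> \<le> (\<Sum>t<horizon P. \<Sum>k=1..K t.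
      (1 + 2 * lip_const P t * D t k / \<delta> t) ^ dim (sspace P t))"
    by (intro sum_mono card_I) auto
  finally show ?thesis .
qed

end

theorem theorem2:
  fixes P :: "('n, 'a::euclidean_space, 'b::euclidean_space) msp"
    and R :: "('n, 'a, 'b) ddp_trace"
    and \<epsilon> :: real and \<delta> :: "nat \<Rightarrow> real"
    and K :: "nat \<Rightarrow> nat" and B :: "nat \<Rightarrow> nat \<Rightarrow> 'a set" and D :: "nat \<Rightarrow> nat \<Rightarrow> real"
    and i :: nat
  assumes "msp_program P" and "finite_feasible P"
    and "msp_penalties P" and "reg_exact P" and "msp_dual_bounds P"
    and "0 < \<epsilon>"
    and "\<And>t. t < horizon P \<Longrightarrow> 0 < \<delta> t" and "(\<Sum>t<horizon P. \<delta> t) = \<epsilon>"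
    and "\<And>t k. t < horizon P \<Longrightarrow> k \<in> {1..K t} \<Longrightarrow>
           norm_ball (sspace P t) (snorm P t) (B t k) \<and>
           0 \<le> D t k \<and> norm_diameter (snorm P t) (B t k) = ereal (D t k)"
    and "\<And>t. t < horizon P \<Longrightarrow> states P t \<subseteq> (\<Union>k\<in>{1..K t}. B t k)"
    and "ddp_terminates_in P \<epsilon> R i"
    and "eps_optimal_root P \<epsilon> (best R i)"
  shows "real i \<le> (\<Sum>t<horizon P. \<Sum>k=1..K t.
           (1 + 2 * lip_const P t * D t k / \<delta> t) ^ dim (sspace P t))"
proof -
  interpret ddp_run P R \<epsilon> i
    using assms by (simp add: ddp_run_def)
  show ?thesis
    using assms by (intro iteration_bound)
qed

end
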